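(* The set $\mathbf{OMC}$ of OMC subshifts is residual in $\mathbf{S}'$; that is, $\mathbf{OMC}\cap\mathbf{S}'$ contains a dense $G_\delta$ subset of $\mathbf{S}'$.
   Context: A subshift is a nonempty compact set $X\subset\mathbb{Z}^{\mathbb{Z}}$ (product topology, $\mathbb{Z}$ discrete) with $\sigma(X)=X$, where $(\sigma x)_i=x_{i+1}$; it is automatically over a finite alphabet. $L_n(X)$ is the set of $n$-letter words occurring in points of $X$. $\mathbf{S}$ is the set of all subshifts with the metric $d(X,Y)=2^{-\inf\{n:L_n(X)\ne L_n(Y)\}}$ ($d(X,X)=0$). $\mathbf{S}'$ is the set of non-isolated points of $\mathbf{S}$, with the subspace topology. The $n$th Rauzy graph $G_{X,n}$ is the directed graph with vertex set $L_{n-1}(X)$ and, for each $w_1\cdots w_n\in L_n(X)$, an edge from $w_1\cdots w_{n-1}$ to $w_2\cdots w_n$. For a cycle $K$, an incoming edge is an edge whose terminal vertex is in $K$ and whose initial vertex is not; an outgoing edge is an edge whose initial vertex is in $K$ and whose terminal vertex is not. A directed graph has the one middle cycle property (OMC) if there exists a unique simple cycle $K$ with both incoming and outgoing edges. A subshift $X$ is OMC if there exists $n$ for which $G_{X,n}$ has OMC. *)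

theory Defs
  imports "HOL-Analysis.Analysis" "Graph_Theory.Arc_Walk"
begin

definition shift :: "(int \<Rightarrow> int) \<Rightarrow> int \<Rightarrow> int" where
  "shift x = (\<lambda>i. x (i + 1))"

text \<open>Compactness refers to the library's product topology on functions, where
  \<^typ>\<open>int\<close> carries the discrete topology.\<close>

definition subshift :: "(int \<Rightarrow> int) set \<Rightarrow> bool" where
  "subshift X \<longleftrightarrow> X \<noteq> {} \<and> compact X \<and> shift ` X = X"

definition language :: "nat \<Rightarrow> (int \<Rightarrow> int) set \<Rightarrow> int list set" where
  "language n X = {map (\<lambda>k. x (i + int k)) [0..<n] | x i. x \<in> X}"

definition subshift_dist :: "(int \<Rightarrow> int) set \<Rightarrow> (int \<Rightarrow> int) set \<Rightarrow> real" where
  "subshift_dist X Y =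
     (if X = Y then 0 else 2 powr - real (Inf {n. language n X \<noteq> language n Y}))"

lemma shift_funpow_mem:
  assumes "shift ` X = X" "x \<in> X"
  shows "(\<lambda>i. x (i + int n)) \<in> X"
proof (induction n)
  case (Suc n)
  have "shift (\<lambda>i. x (i + int n)) \<in> X"
    using Suc assms(1) by blast
  moreover have "shift (\<lambda>i. x (i + int n)) = (\<lambda>i. x (i + int (Suc n)))"
    by (simp add: shift_def add_ac)
  ultimately show ?case by simp
qed (use assms in simp)

lemma shift_funpow_mem_neg:
  assumes "shift ` X = X" "x \<in> X"
  shows "(\<lambda>i. x (i - int n)) \<in> X"
proof (induction n)
  case (Suc n)
  then obtain y where y: "y \<in> X" "(\<lambda>i. x (i - int n)) = shift y"
    using assms(1) by (metis imageE)
  have "y i = x (i - int (Suc n))" for i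
  proof -
    have "y i = shift y (i - 1)" by (simp add: shift_def)
    also have "\<dots> = x (i - 1 - int n)" by (simp flip: y(2))
    finally show ?thesis by (simp add: algebra_simps)
  qed
  then have "y = (\<lambda>i. x (i - int (Suc n)))" by blast
  with y(1) show ?case by simp
qed (use assms in simp)

lemma shift_int_mem:
  assumes "shift ` X = X" "x \<in> X"
  shows "(\<lambda>i. x (i + k)) \<in> X"
proof (cases "k \<ge> 0")
  case True
  then show ?thesis using shift_funpow_mem[OF assms, of "nat k"] by simp
next
  case False
  then show ?thesis using shift_funpow_mem_neg[OF assms, of "nat (-k)"] by simp
qed

lemma compact_imp_closed_int_fun:
  assumes "compact (Y :: (int \<Rightarrow> int) set)"
  shows "closed Y"
proof -
  have int: "Hausdorff_space (euclidean :: int topology)"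
    unfolding Hausdorff_space_def
  proof (intro allI impI)
    fix x y :: int
    assume "x \<in> topspace euclidean \<and> y \<in> topspace euclidean \<and> x \<noteq> y"
    then have "openin euclidean {x} \<and> openin euclidean {y} \<and> x \<in> {x} \<and> y \<in> {y}
        \<and> disjnt {x} {y}"
      by (simp add: open_discrete)
    then show "\<exists>U V. openin euclidean U \<and> openin euclidean V \<and> x \<in> U \<and> y \<in> V \<and> disjnt U V"
      by blast
  qed
  have "Hausdorff_space (product_topology (\<lambda>i::int. euclidean :: int topology) UNIV)"
    unfolding Hausdorff_space_product_topology using int by simp
  then have "Hausdorff_space (euclidean :: (int \<Rightarrow> int) topology)"
    by (simp only: euclidean_product_topology)
  moreover have "compactin euclidean Y"
    using assms by simp
  ultimately have "closedin euclidean Y"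
    by (rule compactin_imp_closedin)
  then show ?thesis
    by simp
qed

lemma subset_if_language_subset:
  assumes X: "subshift X" and Y: "subshift Y"
    and L: "\<And>n. language n X \<subseteq> language n Y"
  shows "X \<subseteq> Y"
proof
  fix x assume x: "x \<in> X"
  have "\<exists>y\<in>Y. \<forall>i. \<bar>i\<bar> \<le> int n \<longrightarrow> y i = x i" for n
  proof -
    have "map (\<lambda>k. x (- int n + int k)) [0..<2*n+1] \<in> language (2*n+1) Y"
      using x L[of "2*n+1"] unfolding language_def by blast
    then obtain y j where y: "y \<in> Y"
      and eq: "map (\<lambda>k. x (- int n + int k)) [0..<2*n+1]
               = map (\<lambda>k. y (j + int k)) [0..<2*n+1]"
      unfolding language_def by blast
    have eq': "x (- int n + int k) = y (j + int k)" if "k < 2*n+1" for k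
      using eq that by (auto simp: list_eq_iff_nth_eq simp del: upt_Suc)
    have "y (i + (j + int n)) = x i" if i: "\<bar>i\<bar> \<le> int n" for i
    proof -
      define k where "k = nat (i + int n)"
      have k: "int k = i + int n" "k < 2*n+1"
        using i unfolding k_def by linarith+
      have "j + int k = i + (j + int n)" "- int n + int k = i"
        using k(1) by linarith+
      then show ?thesis
        using eq'[OF k(2)] by (simp only:)
    qed
    moreover have "(\<lambda>i. y (i + (j + int n))) \<in> Y"
      using shift_int_mem[OF _ y] Y by (simp add: subshift_def)
    ultimately show ?thesis
      by (intro bexI[of _ "\<lambda>i. y (i + (j + int n))"]) simp_all
  qed
  then have "\<forall>n. \<exists>y. y \<in> Y \<and> (\<forall>i. \<bar>i\<bar> \<le> int n \<longrightarrow> y i = x i)"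
    by (simp add: Bex_def)
  from choice[OF this] obtain y
    where "\<forall>n. y n \<in> Y \<and> (\<forall>i. \<bar>i\<bar> \<le> int n \<longrightarrow> y n i = x i)" ..
  then have y: "\<And>n. y n \<in> Y" "\<And>n i. \<bar>i\<bar> \<le> int n \<Longrightarrow> y n i = x i"
    by simp_all
  have "y \<longlonglongrightarrow> x"
  proof -
    have "(\<lambda>n. y n i) \<longlonglongrightarrow> x i" for i
    proof (rule tendsto_eventually)
      show "\<forall>\<^sub>F n in sequentially. y n i = x i"
        unfolding eventually_sequentially
        using y(2) by (intro exI[of _ "nat \<bar>i\<bar>"]) auto
    qed
    then have "limitin (product_topology (\<lambda>i. euclidean) UNIV) y x sequentially"
      by (simp add: limitin_componentwise)
    then show ?thesis
      by (simp only: euclidean_product_topology limitin_canonical_iff)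
  qed
  moreover have "closed Y"
    using Y by (simp add: subshift_def compact_imp_closed_int_fun)
  ultimately show "x \<in> Y"
    using closed_sequentially[of Y y x] y(1) by blast
qed

lemma subshift_eqI:
  assumes "subshift X" "subshift Y" "\<And>n. language n X = language n Y"
  shows "X = Y"
  using subset_if_language_subset[of X Y] subset_if_language_subset[of Y X] assms by blast

lemma subshift_dist_nonneg: "0 \<le> subshift_dist X Y"
  by (simp add: subshift_dist_def)

lemma subshift_dist_commute: "subshift_dist X Y = subshift_dist Y X"
proof -
  have "{n. language n X \<noteq> language n Y} = {n. language n Y \<noteq> language n X}"
    by metis
  then show ?thesis
    by (simp add: subshift_dist_def)
qed

lemma subshift_dist_ultrametric:
  assumes "subshift X" "subshift Y" "subshift Z"
  shows "subshift_dist X Z \<le> max (subshift_dist X Y) (subshift_dist Y Z)"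
proof (cases "X = Y \<or> Y = Z \<or> X = Z")
  case True
  then show ?thesis
    by (elim disjE) (simp_all add: subshift_dist_nonneg le_max_iff_disj subshift_dist_def[of Z Z])
next
  case False
  let ?D = "\<lambda>X Y. {n. language n X \<noteq> language n Y}"
  have "?D X Z \<noteq> {}"
    using False subshift_eqI assms by blast
  then have "Inf (?D X Z) \<in> ?D X Z"
    by (rule Inf_nat_def1)
  then have "Inf (?D X Z) \<in> ?D X Y \<or> Inf (?D X Z) \<in> ?D Y Z"
    by auto
  then have "Inf (?D X Y) \<le> Inf (?D X Z) \<or> Inf (?D Y Z) \<le> Inf (?D X Z)"
    by (meson wellorder_Inf_le1)
  then show ?thesis
    using False by (simp add: subshift_dist_def le_max_iff_disj)
qed

interpretation subshift_space: Metric_space "Collect subshift" subshift_dist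
proof
  fix X Y Z
  show "0 \<le> subshift_dist X Y"
    by (rule subshift_dist_nonneg)
  show "subshift_dist X Y = subshift_dist Y X"
    by (rule subshift_dist_commute)
  show "subshift_dist X Y = 0 \<longleftrightarrow> X = Y"
    by (simp add: subshift_dist_def)
  assume "X \<in> Collect subshift" "Y \<in> Collect subshift" "Z \<in> Collect subshift"
  then show "subshift_dist X Z \<le> subshift_dist X Y + subshift_dist Y Z"
    using subshift_dist_ultrametric[of X Y Z] subshift_dist_nonneg[of X Y]
      subshift_dist_nonneg[of Y Z] by simp
qed

definition non_isolated_subshifts :: "(int \<Rightarrow> int) set set" where
  "non_isolated_subshifts = {X. subshift X \<and> \<not> openin subshift_space.mtopology {X}}"

text \<open>The arcs are the \<open>n\<close>-letter words themselves, so that for \<open>n = 1\<close> there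
  is one loop at the empty word for each letter. Only \<open>n \<ge> 1\<close> is meaningful.\<close>

definition rauzy_graph :: "(int \<Rightarrow> int) set \<Rightarrow> nat \<Rightarrow> (int list, int list) pre_digraph" where
  "rauzy_graph X n =
     \<lparr>verts = language (n - 1) X, arcs = language n X, tail = butlast, head = tl\<rparr>"

text \<open>A library cycle is a list of arcs (loops are allowed, no vertex is repeated) and
  hence has a starting point. We use its set of arcs instead, which for a cycle without
  repeated vertices determines the list up to rotation, so that uniqueness of cycles does
  not depend on the starting point.\<close>

definition simple_cycles :: "('v, 'e) pre_digraph \<Rightarrow> 'e set set" where
  "simple_cycles G = {set p | p. pre_digraph.cycle G p}"

definition cycle_verts :: "('v, 'e) pre_digraph \<Rightarrow> 'e set \<Rightarrow> 'v set" where
  "cycle_verts G K = tail G ` K \<union> head G ` K"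

definition incoming_arcs :: "('v, 'e) pre_digraph \<Rightarrow> 'e set \<Rightarrow> 'e set" where
  "incoming_arcs G K =
     {e \<in> arcs G. head G e \<in> cycle_verts G K \<and> tail G e \<notin> cycle_verts G K}"

definition outgoing_arcs :: "('v, 'e) pre_digraph \<Rightarrow> 'e set \<Rightarrow> 'e set" where
  "outgoing_arcs G K =
     {e \<in> arcs G. tail G e \<in> cycle_verts G K \<and> head G e \<notin> cycle_verts G K}"

definition one_middle_cycle :: "('v, 'e) pre_digraph \<Rightarrow> bool" where
  "one_middle_cycle G \<longleftrightarrow>
     (\<exists>!K. K \<in> simple_cycles G \<and> incoming_arcs G K \<noteq> {} \<and> outgoing_arcs G K \<noteq> {})"

definition OMC :: "(int \<Rightarrow> int) set set" where
  "OMC = {X. subshift X \<and> (\<exists>n\<ge>1. one_middle_cycle (rauzy_graph X n))}"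

definition residual_in :: "'a topology \<Rightarrow> 'a set \<Rightarrow> bool" where
  "residual_in T A \<longleftrightarrow>
     (\<exists>D. D \<subseteq> A \<and> gdelta_in T D \<and> T closure_of D = topspace T)"

end

theory Submission
  imports Defs
begin

text \<open>The OMC subshifts are open, so the theorem reduces to density: near every non-isolated subshift \<open>X\<close>
there is a non-isolated subshift \<open>Y\<close> with the same words of length \<open>n\<close> and with OMC at some, much
higher, level.

Consider the Rauzy graph of \<open>X\<close> with arcs the words of length \<open>n\<close>, and call a periodic path \<open>\<kappa>\<close> in it
middle if some other path falls into it and some other path leaves it. If there were no middle path,
every path in the graph would run from one cycle to another through a bounded gap, and there would be
finitely many paths up to translation. Then finitely many subshifts would have the same words as \<open>X\<close>,
and \<open>X\<close> would be isolated (\<open>middle_if_not_isolated\<close>).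

So fix a middle path \<open>\<kappa>\<close>. Choose cycles through the vertices of the components that cannot be
entered (sources) and of those that cannot be left (sinks), none of them in the orbit of \<open>\<kappa>\<close>. This
is possible: such a component is either more than a single cycle, and then each of its vertices lies
on infinitely many periodic paths, or it is a single cycle that cannot be entered or cannot be left,
and then it is not the cycle of \<open>\<kappa>\<close>. For the same reason sources and sinks can be kept apart, except
in components that are single cycles without any connection to the rest of the graph. Let \<open>Y\<close> be generated by one path from a source to a sink through each arc, one path
from a source to \<open>\<kappa>\<close>, and one path from \<open>\<kappa>\<close> to a sink (\<open>connecting_points\<close>). The words of length \<open>n\<close>
of \<open>Y\<close> are those of \<open>X\<close>.

For long words, the Rauzy graphs of \<open>Y\<close> look like the generators: disjoint cycles for the sources, \<open>\<kappa>\<close>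
and the sinks, and arcs that lead from a cycle of lower rank to one of higher rank, where sources have
rank 0, \<open>\<kappa>\<close> has rank 1 and sinks have rank 2. Since ranks cannot go down, there are no further cycles,
and \<open>\<kappa>\<close> is the only one with arcs in and out (\<open>one_middle_cycle_if_graded\<close>).

Finally \<open>Y\<close> is not isolated. As \<open>\<kappa>\<close> and the paths into and out of it belong to \<open>Y\<close>, it is middle
in every Rauzy graph of \<open>Y\<close>. Repeating the construction there with only the paths from
sources to sinks yields subshifts arbitrarily close to \<open>Y\<close> that do not contain \<open>\<kappa>\<close>
(\<open>not_isolated_if_middle\<close>).\<close>

section \<open>Factors, translates and periodic sequences\<close>

definition factor :: "(int \<Rightarrow> int) \<Rightarrow> int \<Rightarrow> nat \<Rightarrow> int list" where
  "factor x i n = map (\<lambda>k. x (i + int k)) [0..<n]"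

definition translate :: "int \<Rightarrow> (int \<Rightarrow> int) \<Rightarrow> int \<Rightarrow> int" where
  "translate k x = (\<lambda>i. x (i + k))"

definition periodic :: "int \<Rightarrow> (int \<Rightarrow> int) \<Rightarrow> bool" where
  "periodic L x \<longleftrightarrow> 0 < L \<and> (\<forall>i. x (i + L) = x i)"

text \<open>Gluing is the only way paths are built below: two bi-infinite paths that meet in a vertex, that is,
two sequences sharing a window, are joined there.\<close>

definition glue :: "int \<Rightarrow> (int \<Rightarrow> int) \<Rightarrow> (int \<Rightarrow> int) \<Rightarrow> int \<Rightarrow> int" where
  "glue i x y = (\<lambda>j. if j < i then x j else y j)"

definition orbit :: "(int \<Rightarrow> int) \<Rightarrow> (int \<Rightarrow> int) set" where
  "orbit x = range (\<lambda>k. translate k x)"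

lemma language_eq_factors: "language n X = {factor x i n | x i. x \<in> X}"
  by (simp add: language_def factor_def)

lemma length_factor [simp]: "length (factor x i n) = n"
  by (simp add: factor_def)

lemma factor_eq_iff:
  "factor x i n = factor y j n \<longleftrightarrow> (\<forall>k. 0 \<le> k \<and> k < int n \<longrightarrow> x (i + k) = y (j + k))"
proof
  assume *: "factor x i n = factor y j n"
  show "\<forall>k. 0 \<le> k \<and> k < int n \<longrightarrow> x (i + k) = y (j + k)"
  proof (intro allI impI)
    fix k assume k: "0 \<le> k \<and> k < int n"
    then have "nat k < n" by linarith
    then have "factor x i n ! nat k = x (i + k)" "factor y j n ! nat k = y (j + k)"
      using k by (simp_all add: factor_def)
    with * show "x (i + k) = y (j + k)" by simp
  qed
next
  assume "\<forall>k. 0 \<le> k \<and> k < int n \<longrightarrow> x (i + k) = y (j + k)"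
  then show "factor x i n = factor y j n"
    unfolding factor_def by (intro map_cong) auto
qed

lemma factor_eqD:
  assumes "factor x i n = factor y j n" "i \<le> t" "t < i + int n"
  shows "x t = y (t - i + j)"
proof -
  have "x (i + (t - i)) = y (j + (t - i))"
    using assms(1)[unfolded factor_eq_iff, rule_format, of "t - i"] assms(2,3) by simp
  then show ?thesis by (simp add: algebra_simps)
qed

lemma factor_eqI:
  assumes "\<And>t. i \<le> t \<Longrightarrow> t < i + int n \<Longrightarrow> x t = y (t - i + j)"
  shows "factor x i n = factor y j n"
  unfolding factor_eq_iff
proof (intro allI impI)
  fix k assume "0 \<le> k \<and> k < int n"
  then show "x (i + k) = y (j + k)"
    using assms[of "i + k"] by (simp add: add.commute)
qed

lemma factor_cong:
  assumes "\<And>t. i \<le> t \<Longrightarrow> t < i + int n \<Longrightarrow> x t = y t"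
  shows "factor x i n = factor y i n"
  using assms by (intro factor_eqI) simp

lemma factor_translate [simp]: "factor (translate k x) i n = factor x (i + k) n"
  by (simp add: factor_def translate_def add_ac)

lemma butlast_factor: "butlast (factor x i (Suc n)) = factor x i n"
  by (simp add: factor_def)

lemma tl_factor: "tl (factor x i (Suc n)) = factor x (i + 1) n"
proof -
  have "[0..<Suc n] = 0 # map Suc [0..<n]"
    by (metis map_Suc_upt upt_conv_Cons zero_less_Suc)
  then show ?thesis
    unfolding factor_def by (simp add: add_ac o_def del: upt_Suc)
qed

lemma translate_0 [simp]: "translate 0 x = x"
  by (simp add: translate_def)

lemma translate_translate [simp]: "translate i (translate j x) = translate (i + j) x"
  by (simp add: translate_def add_ac)

lemma translate_apply: "translate k x i = x (i + k)"
  by (simp add: translate_def)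

lemma in_orbit [simp]: "translate k x \<in> orbit x"
  by (simp add: orbit_def)

lemma self_in_orbit [simp]: "x \<in> orbit x"
  by (metis in_orbit translate_0)

lemma orbitE:
  assumes "y \<in> orbit x"
  obtains k where "y = translate k x"
  using assms by (auto simp: orbit_def)

lemma translate_in_orbit_iff [simp]: "translate k y \<in> orbit x \<longleftrightarrow> y \<in> orbit x"
proof
  assume "translate k y \<in> orbit x"
  then obtain l where "translate k y = translate l x" by (rule orbitE)
  then have "translate (-k) (translate k y) = translate (-k) (translate l x)" by (rule arg_cong)
  then show "y \<in> orbit x" by (simp) 
next
  assume "y \<in> orbit x"
  then obtain l where "y = translate l x" by (rule orbitE)
  then show "translate k y \<in> orbit x" by simp
qed

lemma orbit_sym: "y \<in> orbit x \<Longrightarrow> x \<in> orbit y"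
  by (metis self_in_orbit orbitE translate_in_orbit_iff)

lemma orbit_trans: "z \<in> orbit y \<Longrightarrow> y \<in> orbit x \<Longrightarrow> z \<in> orbit x"
  by (metis orbitE translate_in_orbit_iff)

lemma periodic_pos: "periodic L x \<Longrightarrow> 0 < L"
  by (simp add: periodic_def)

lemma periodic_add_mult:
  assumes "periodic L x"
  shows "x (i + L * k) = x i"
proof -
  have *: "x (i + L * int n) = x i" for n i
  proof (induction n)
    case (Suc n)
    have "x ((i + L * int n) + L) = x (i + L * int n)"
      using assms by (simp add: periodic_def)
    then show ?case using Suc by (simp add: algebra_simps)
  qed simp
  show ?thesis
  proof (cases "k \<ge> 0")
    case True
    then show ?thesis using *[of i "nat k"] by simp
  next
    case False
    then show ?thesis using *[of "i + L * k" "nat (-k)"] by (simp add: algebra_simps)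
  qed
qed

lemma periodic_mult:
  assumes "periodic L x" "0 < k"
  shows "periodic (L * k) x"
  using assms periodic_add_mult[OF assms(1)] by (simp add: periodic_def)

lemma periodic_translate: "periodic L x \<Longrightarrow> periodic L (translate k x)"
proof -
  assume p: "periodic L x"
  have "x (i + L + k) = x (i + k)" for i
    using periodic_add_mult[OF p, of "i + k" 1] by (simp add: algebra_simps)
  with p show ?thesis by (simp add: periodic_def translate_def)
qed

lemma periodic_eq_mod:
  assumes "periodic L x"
  shows "x (a + (i - a) mod L) = x i"
proof -
  have "x (a + (i - a) mod L + L * ((i - a) div L)) = x (a + (i - a) mod L)"
    by (rule periodic_add_mult[OF assms])
  moreover have "a + (i - a) mod L + L * ((i - a) div L) = i"
    by simp
  ultimately show ?thesis by metis
qed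

lemma periodic_eqI:
  assumes "periodic L x" "periodic L y" "\<And>t. a \<le> t \<Longrightarrow> t < a + L \<Longrightarrow> x t = y t"
  shows "x = y"
proof
  fix i
  have L: "0 < L" using assms(1) by (rule periodic_pos)
  have "x (a + (i - a) mod L) = y (a + (i - a) mod L)"
    using L by (intro assms(3)) simp_all
  then show "x i = y i"
    using periodic_eq_mod[OF assms(1)] periodic_eq_mod[OF assms(2)] by metis
qed

lemma periodic_eq_right:
  assumes "periodic L x" "periodic L' y" "\<And>t. a \<le> t \<Longrightarrow> x t = y t"
  shows "x = y"
proof (rule periodic_eqI)
  show "periodic (L * L') x"
    by (rule periodic_mult[OF assms(1) periodic_pos[OF assms(2)]])
  show "periodic (L * L') y"
    using periodic_mult[OF assms(2) periodic_pos[OF assms(1)]] by (simp add: mult.commute)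
qed (use assms(3) in blast)

lemma periodic_eq_left:
  assumes "periodic L x" "periodic L' y" "\<And>t. t < a \<Longrightarrow> x t = y t"
  shows "x = y"
proof (rule periodic_eqI)
  show "periodic (L * L') x"
    by (rule periodic_mult[OF assms(1) periodic_pos[OF assms(2)]])
  show "periodic (L * L') y"
    using periodic_mult[OF assms(2) periodic_pos[OF assms(1)]] by (simp add: mult.commute)
  fix t assume "t < (a - L * L') + L * L'"
  then show "x t = y t" using assms(3) by simp
qed

lemma translate_period_mult: "periodic L x \<Longrightarrow> translate (L * k) x = x"
  by (rule ext) (simp add: translate_def periodic_add_mult)

lemma finite_orbit:
  assumes "periodic L x"
  shows "finite (orbit x)"
proof -
  have "orbit x \<subseteq> (\<lambda>k. translate k x) ` {0..<L}"
  proof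
    fix y assume "y \<in> orbit x"
    then obtain k where y: "y = translate k x" by (rule orbitE)
    have "translate (k mod L) x = translate (k mod L) (translate (L * (k div L)) x)"
      by (simp only: translate_period_mult[OF assms])
    also have "\<dots> = translate (k mod L + L * (k div L)) x"
      by (rule translate_translate)
    also have "k mod L + L * (k div L) = k"
      by (rule mod_mult_div_eq)
    finally have "y = translate (k mod L) x"
      using y by (simp only:)
    then show "y \<in> (\<lambda>k. translate k x) ` {0..<L}"
      using periodic_pos[OF assms] by simp
  qed
  then show ?thesis by (rule finite_subset) simp
qed

lemma periodic_orbit: "periodic L x \<Longrightarrow> y \<in> orbit x \<Longrightarrow> periodic L y"
  by (metis orbitE periodic_translate)

lemma common_period:
  assumes "finite F" "\<And>x. x \<in> F \<Longrightarrow> \<exists>L. periodic L x"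
  shows "\<exists>L. 0 < L \<and> (\<forall>x\<in>F. periodic L x)"
  using assms
proof (induction F rule: finite_induct)
  case empty
  then show ?case by (intro exI[of _ 1]) simp
next
  case (insert x F)
  from insert.prems obtain L' where L': "periodic L' x" by auto
  from insert.IH insert.prems obtain L where L: "0 < L" "\<forall>x\<in>F. periodic L x"
    by auto
  have "periodic (L * L') x"
    using periodic_mult[OF L' L(1)] by (simp add: mult.commute)
  moreover have "periodic (L * L') y" if "y \<in> F" for y
    using periodic_mult[of L y L'] L(2) that periodic_pos[OF L'] by simp
  moreover have "0 < L * L'"
    using L(1) periodic_pos[OF L'] by simp
  ultimately show ?case by auto
qed

lemma glue_left: "j < i \<Longrightarrow> glue i x y j = x j"
  by (simp add: glue_def)

lemma glue_right: "i \<le> j \<Longrightarrow> glue i x y j = y j"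
  by (simp add: glue_def)

lemma glue_left_overlap:
  assumes "factor x i N = factor y i N" "j < i + int N"
  shows "glue i x y j = x j"
  using factor_eqD[OF assms(1), of j] assms(2) by (simp add: glue_def)

section \<open>Paths and cycles in a Rauzy graph\<close>

text \<open>The points of \<open>sft N A\<close> are the bi-infinite paths of the graph whose arcs are the words of \<open>A\<close>, of
length \<open>N + 1\<close>, and whose vertices are words of length \<open>N\<close>. For \<open>A = language (N + 1) X\<close> this graph is
a Rauzy graph of \<open>X\<close>. Finite paths are always handled as pieces of bi-infinite ones, so no separate
notion of walk is needed.\<close>

locale sft =
  fixes N :: nat and A :: "int list set"
  assumes finite_words: "finite A"
begin

definition points :: "(int \<Rightarrow> int) set" where
  "points = {x. \<forall>i. factor x i (Suc N) \<in> A}"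

lemma pointsD: "x \<in> points \<Longrightarrow> factor x i (Suc N) \<in> A"
  by (simp add: points_def)

lemma points_letters:
  assumes "x \<in> points"
  shows "x i \<in> \<Union> (set ` A)"
proof -
  have "x i \<in> set (factor x i (Suc N))"
    unfolding factor_def set_map by (rule image_eqI[of _ _ 0]) (simp_all del: upt_Suc)
  then show ?thesis using pointsD[OF assms] by blast
qed

lemma translate_points_iff [simp]: "translate k x \<in> points \<longleftrightarrow> x \<in> points"
proof -
  have "(\<forall>i. factor x (i + k) (Suc N) \<in> A) \<longleftrightarrow> (\<forall>i. factor x i (Suc N) \<in> A)"
    by (metis diff_add_cancel)
  then show ?thesis by (simp add: points_def)
qed

lemma glue_points:
  assumes "x \<in> points" "y \<in> points" "factor x i N = factor y i N"
  shows "glue i x y \<in> points"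
proof -
  have "factor (glue i x y) j (Suc N) \<in> A" for j
  proof (cases "j < i")
    case True
    then have "factor (glue i x y) j (Suc N) = factor x j (Suc N)"
      by (intro factor_cong glue_left_overlap[OF assms(3)]) simp
    then show ?thesis using pointsD[OF assms(1)] by simp
  next
    case False
    then have "factor (glue i x y) j (Suc N) = factor y j (Suc N)"
      by (intro factor_cong) (simp add: glue_def)
    then show ?thesis using pointsD[OF assms(2)] by simp
  qed
  then show ?thesis by (simp add: points_def)
qed

text \<open>A closed path can be repeated for ever. The claim includes the \<open>N\<close> letters after one period, so
that the periodic path visits the same vertices as the given one, both ends included.\<close>

lemma closing:
  assumes x: "x \<in> points" and k: "0 < k" and eq: "factor x k N = factor x 0 N"
  obtains p where "p \<in> points" "periodic k p" "\<forall>j\<in>{0..<k + int N}. p j = x j"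
proof -
  define p where "p = (\<lambda>i. x (i mod k))"
  have per: "periodic k p"
    using k by (simp add: periodic_def p_def)
  \<comment> \<open>If \<open>k < N\<close>, the windows at \<open>0\<close> and \<open>k\<close> overlap; the agreement then propagates in steps of \<open>k\<close>.\<close>
  have agree: "p (int n) = x (int n)" if "int n < k + int N" for n
    using that
  proof (induction n rule: less_induct)
    case (less n)
    show ?case
    proof (cases "int n < k")
      case True
      then show ?thesis by (simp add: p_def)
    next
      case False
      then have "p (int (nat (int n - k))) = x (int (nat (int n - k)))"
        using less.prems k by (intro less.IH) linarith+
      then have "p (int n - k) = x (int n - k)"
        using False by simp
      moreover have "p (int n - k) = p (int n)"
        by (simp add: p_def)
      moreover have "x (int n) = x (int n - k)"
        using factor_eqD[OF eq, of "int n"] False less.prems by simp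
      ultimately show ?thesis by simp
    qed
  qed
  have agree': "p j = x j" if "0 \<le> j" "j < k + int N" for j
    using that agree[of "nat j"] by simp
  have "factor p i (Suc N) = factor x (i mod k) (Suc N)" for i
  proof (rule factor_eqI)
    fix t assume t: "i \<le> t" "t < i + int (Suc N)"
    have "p t = p (t - i + i mod k)"
      unfolding p_def by (metis diff_add_cancel mod_add_right_eq)
    also have "\<dots> = x (t - i + i mod k)"
    proof (rule agree')
      have "0 \<le> i mod k" "i mod k < k" using k by simp_all
      then show "0 \<le> t - i + i mod k" "t - i + i mod k < k + int N"
        using t by simp_all
    qed
    finally show "p t = x (t - i + i mod k)" .
  qed
  then have "p \<in> points"
    using pointsD[OF x] by (simp add: points_def)
  with per agree' that show ?thesis by simp
qed

definition vertices :: "int list set" where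
  "vertices = {factor x 0 N | x. x \<in> points}"

definition reach :: "int list \<Rightarrow> int list \<Rightarrow> bool" where
  "reach v w \<longleftrightarrow> (\<exists>x\<in>points. \<exists>k\<ge>0. factor x 0 N = v \<and> factor x k N = w)"

text \<open>Cycles are recorded as periodic points with \<open>w\<close> at the origin. Running around a cycle several times
thus gives nothing new, whereas different visits to \<open>w\<close> within one period may give different points.\<close>

definition cycles_at :: "int list \<Rightarrow> (int \<Rightarrow> int) set" where
  "cycles_at w = {p \<in> points. (\<exists>L. periodic L p) \<and> factor p 0 N = w}"

lemma cycles_atD:
  assumes "p \<in> cycles_at w"
  shows "p \<in> points" "factor p 0 N = w" "\<exists>L. periodic L p"
  using assms by (auto simp: cycles_at_def)

lemma factor_in_vertices: "x \<in> points \<Longrightarrow> factor x i N \<in> vertices"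
  using translate_points_iff[of i x] unfolding vertices_def
  by (intro CollectI exI[of _ "translate i x"]) simp

lemma finite_vertices: "finite vertices"
proof (rule finite_subset)
  show "vertices \<subseteq> butlast ` A"
  proof
    fix w assume "w \<in> vertices"
    then obtain x where "x \<in> points" "w = factor x 0 N"
      by (auto simp: vertices_def)
    then have "w = butlast (factor x 0 (Suc N))" "factor x 0 (Suc N) \<in> A"
      by (simp_all add: butlast_factor pointsD)
    then show "w \<in> butlast ` A" by (rule image_eqI)
  qed
qed (simp add: finite_words)

lemma reachI:
  assumes "x \<in> points" "i \<le> j"
  shows "reach (factor x i N) (factor x j N)"
  unfolding reach_def
  by (intro bexI[of _ "translate i x"] exI[of _ "j - i"]) (use assms in simp_all)

lemma reach_vertices: "reach v w \<Longrightarrow> v \<in> vertices \<and> w \<in> vertices"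
  by (auto simp: reach_def factor_in_vertices)

lemma reach_refl: "v \<in> vertices \<Longrightarrow> reach v v"
  using reachI[of _ 0 0] by (auto simp: vertices_def)

lemma reach_join:
  assumes x: "x \<in> points" and r: "reach (factor x i N) w"
  obtains y k where "y \<in> points" "i \<le> k" "\<forall>j<i + int N. y j = x j" "factor y k N = w"
proof -
  obtain z l where z: "z \<in> points" "0 \<le> l" "factor z 0 N = factor x i N" "factor z l N = w"
    using r by (auto simp: reach_def)
  let ?y = "glue i x (translate (-i) z)"
  have eq: "factor x i N = factor (translate (-i) z) i N"
    using z by simp
  have "?y \<in> points"
    using x z eq by (intro glue_points) simp_all
  moreover have "factor ?y (i + l) N = factor (translate (-i) z) (i + l) N"
    using z(2) by (intro factor_cong) (simp add: glue_right)
  then have "factor ?y (i + l) N = w"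
    using z(4) by simp
  ultimately show ?thesis
    using that[of ?y "i + l"] glue_left_overlap[OF eq] z(2) by simp
qed

lemma reach_trans:
  assumes "reach u v" "reach v w"
  shows "reach u w"
proof -
  obtain x l where x: "x \<in> points" "0 \<le> l" "factor x 0 N = u" "factor x l N = v"
    using assms(1) by (auto simp: reach_def)
  then have "reach (factor x l N) w"
    using assms(2) by simp
  with x(1) obtain y k where y: "y \<in> points" "l \<le> k" "\<forall>j<l + int N. y j = x j"
    "factor y k N = w"
    by (rule reach_join)
  have "factor y 0 N = u"
    unfolding x(3)[symmetric] using x(2) y(3) by (intro factor_cong) simp
  then show ?thesis
    using y x(2) reachI[of y 0 k] by simp
qed

lemma closing_reach:
  assumes x: "x \<in> points" and k: "0 < k" and r: "reach (factor x k N) (factor x 0 N)"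
  obtains p where "p \<in> cycles_at (factor x 0 N)" "\<forall>j\<in>{0..<k + int N}. p j = x j"
proof -
  obtain y l where y: "y \<in> points" "k \<le> l" "\<forall>j<k + int N. y j = x j"
    "factor y l N = factor x 0 N"
    by (rule reach_join[OF x r])
  have eq: "factor y 0 N = factor x 0 N"
    using k y(3) by (intro factor_cong) simp
  obtain p where p: "p \<in> points" "periodic l p" "\<forall>j\<in>{0..<l + int N}. p j = y j"
    by (rule closing[of y l]) (use y k eq in auto)
  have "factor p 0 N = factor y 0 N"
    using k y(2) p(3) by (intro factor_cong) simp
  then have "p \<in> cycles_at (factor x 0 N)"
    using p eq by (auto simp: cycles_at_def)
  moreover have "\<forall>j\<in>{0..<k + int N}. p j = x j"
    using p(3) y(2,3) by simp
  ultimately show ?thesis using that by blast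
qed

text \<open>If only one periodic path runs through a vertex, then every path that leaves the vertex and can
still come back must follow it: otherwise closing the path up gives a second one.\<close>

lemma unique_cycle_right:
  assumes x: "x \<in> points" and k: "0 < k" and r: "reach (factor x k N) (factor x 0 N)"
    and u: "cycles_at (factor x 0 N) \<subseteq> {p}" and j: "0 \<le> j" "j < k + int N"
  shows "x j = p j"
proof -
  obtain p' where p': "p' \<in> cycles_at (factor x 0 N)"
    "\<forall>j\<in>{0..<k + int N}. p' j = x j"
    by (rule closing_reach[OF x k r])
  with u have "p' = p" by blast
  with p'(2) j show ?thesis by simp
qed

lemma unique_cycle_left:
  assumes x: "x \<in> points" and k: "0 < k" and r: "reach (factor x 0 N) (factor x (-k) N)"
    and u: "cycles_at (factor x 0 N) \<subseteq> {p}" and j: "-k \<le> j" "j < int N"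
  shows "x j = p j"
proof -
  let ?x = "translate (-k) x"
  have r': "reach (factor ?x k N) (factor ?x 0 N)"
    using r by simp
  obtain p' where p': "p' \<in> cycles_at (factor ?x 0 N)"
    "\<forall>j\<in>{0..<k + int N}. p' j = ?x j"
    using closing_reach[OF _ k r'] x by auto
  have agree: "translate k p' i = x i" if "-k \<le> i" "i < int N" for i
    using bspec[OF p'(2), of "i + k"] that by (simp add: translate_apply)
  have "factor (translate k p') 0 N = factor x 0 N"
    using agree k by (intro factor_cong) simp
  moreover have "\<exists>L. periodic L (translate k p')"
    using cycles_atD(3)[OF p'(1)] periodic_translate by blast
  moreover have "translate k p' \<in> points"
    using cycles_atD(1)[OF p'(1)] by simp
  ultimately have "translate k p' \<in> cycles_at (factor x 0 N)"
    unfolding cycles_at_def by blast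
  with u have "translate k p' = p" by blast
  with agree[OF j] show ?thesis by simp
qed

text \<open>Two distinct periodic paths through \<open>w\<close> can be cut into closed paths \<open>a\<close> and \<open>b\<close> of the same
length. The periodic paths \<open>a b\<^sup>m\<close> are pairwise distinct, because the block after \<open>a b\<^sup>m\<close> is \<open>a\<close> in one
and \<open>b\<close> in the others. So a vertex carries no cycle, exactly one, or infinitely many, and in the
last case any finite set of periodic sequences can be avoided.\<close>

lemma infinite_cycles_at:
  assumes p: "p \<in> cycles_at w" and q: "q \<in> cycles_at w" and ne: "p \<noteq> q"
  shows "infinite (cycles_at w)"
proof -
  note [simp] = cycles_atD(1)[OF p] cycles_atD(1)[OF q]
  have "finite {p, q}" "\<And>x. x \<in> {p, q} \<Longrightarrow> \<exists>L. periodic L x"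
    using cycles_atD(3)[OF p] cycles_atD(3)[OF q] by auto
  then obtain L where L: "0 < L" "periodic L p" "periodic L q"
    using common_period[of "{p, q}"] by auto
  have wp: "factor p (L * k) N = w" for k
    using cycles_atD(2)[OF p] translate_period_mult[OF L(2), of k]
    by (metis add_0 factor_translate)
  have wq: "factor q (L * k) N = w" for k
    using cycles_atD(2)[OF q] translate_period_mult[OF L(3), of k]
    by (metis add_0 factor_translate)
  \<comment> \<open>\<open>x\<close> spells \<open>a b b b \<dots>\<close> to the right of the origin; it is closed up after \<open>m + 1\<close> blocks.\<close>
  define x where "x = glue L p q"
  have x: "x \<in> points"
    unfolding x_def using wp[of 1] wq[of 1] by (intro glue_points) simp_all
  have "factor x 0 N = factor p 0 N"
    unfolding x_def using L(1) wp[of 1] wq[of 1]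
    by (intro factor_cong) (simp add: glue_left_overlap[of p L N q])
  then have x0: "factor x 0 N = w"
    using cycles_atD(2)[OF p] by simp
  have "\<exists>z. z \<in> cycles_at w \<and> periodic (L * (int m + 1)) z \<and>
      (\<forall>j. 0 \<le> j \<and> j < L * (int m + 1) \<longrightarrow> z j = x j)" for m
  proof -
    have pos: "L \<le> L * (int m + 1)" "0 < L * (int m + 1)" using L(1) by simp_all
    have "factor x (L * (int m + 1)) N = factor q (L * (int m + 1)) N"
      unfolding x_def using pos by (intro factor_cong) (simp add: glue_right)
    then have eq: "factor x (L * (int m + 1)) N = factor x 0 N"
      using wq x0 by simp
    obtain z where z: "z \<in> points" "periodic (L * (int m + 1)) z"
      "\<forall>j\<in>{0..<L * (int m + 1) + int N}. z j = x j"
      by (rule closing[OF x pos(2) eq])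
    have "factor z 0 N = w"
      unfolding x0[symmetric] using z(3) pos by (intro factor_cong) simp
    then have "z \<in> cycles_at w"
      using z(1,2) by (auto simp: cycles_at_def)
    then show ?thesis using z by auto
  qed
  then obtain z where z: "\<And>m::nat. z m \<in> cycles_at w"
    "\<And>m. periodic (L * (int m + 1)) (z m)"
    "\<And>m j. 0 \<le> j \<Longrightarrow> j < L * (int m + 1) \<Longrightarrow> z m j = x j"
    by metis
  have neq: "z m \<noteq> z n" if "m < n" for m n
  proof
    assume eq: "z m = z n"
    have "p = q"
    proof (rule periodic_eqI[OF L(2,3)])
      fix t assume t: "0 \<le> t" "t < 0 + L"
      have le: "L * (int m + 2) \<le> L * (int n + 1)" "L * 1 \<le> L * (int m + 1)"
        using that L(1) by (intro mult_left_mono; simp)+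
      have "p t = z m t"
        using z(3)[of t m] t le by (simp add: x_def glue_left)
      also have "\<dots> = z m (t + L * (int m + 1))"
        using z(2)[of m] by (simp add: periodic_def)
      also have "\<dots> = z n (t + L * (int m + 1))"
        using eq by simp
      also have "\<dots> = x (t + L * (int m + 1))"
        using t le L(1) by (intro z(3)) (simp_all add: algebra_simps)
      also have "\<dots> = q (t + L * (int m + 1))"
        unfolding x_def using t le(2) by (intro glue_right) linarith
      also have "\<dots> = q t"
        by (rule periodic_add_mult[OF L(3)])
      finally show "p t = q t" .
    qed
    with ne show False ..
  qed
  have "inj z"
    by (rule injI) (metis neq nat_neq_iff)
  then have "infinite (range z)"
    by (rule range_inj_infinite)
  moreover have "range z \<subseteq> cycles_at w"
    using z(1) by blast
  ultimately show ?thesis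
    using finite_subset by blast
qed

end

section \<open>No middle point implies isolated\<close>

definition left_tail :: "(int \<Rightarrow> int) \<Rightarrow> (int \<Rightarrow> int) \<Rightarrow> bool" where
  "left_tail x p \<longleftrightarrow> (\<exists>a. \<forall>j<a. x j = p j)"

definition right_tail :: "(int \<Rightarrow> int) \<Rightarrow> (int \<Rightarrow> int) \<Rightarrow> bool" where
  "right_tail x p \<longleftrightarrow> (\<exists>a. \<forall>j\<ge>a. x j = p j)"

context sft
begin

text \<open>A path version of a cycle with incoming and outgoing arcs: some other path falls into \<open>\<kappa>\<close>, and some
other path leaves it. Unlike the condition on arcs it does not refer to the word length: if \<open>\<kappa>\<close> and
the two witnesses belong to a subshift, then \<open>\<kappa>\<close> is a middle point at every level.\<close>

definition middle :: "(int \<Rightarrow> int) \<Rightarrow> bool" where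
  "middle \<kappa> \<longleftrightarrow> \<kappa> \<in> points \<and> (\<exists>L. periodic L \<kappa>) \<and>
     (\<exists>u\<in>points. u \<noteq> \<kappa> \<and> right_tail u \<kappa>) \<and> (\<exists>v\<in>points. v \<noteq> \<kappa> \<and> left_tail v \<kappa>)"

definition periodic_points :: "(int \<Rightarrow> int) set" where
  "periodic_points = {p \<in> points. \<exists>L. periodic L p}"

lemma translate_periodic_points: "p \<in> periodic_points \<Longrightarrow> translate k p \<in> periodic_points"
  by (auto simp: periodic_points_def intro: periodic_translate)

text \<open>Switching at \<open>w\<close> from one cycle to the other gives both a path into the first cycle and a path out
of it.\<close>

lemma unique_cycle_if_no_middle:
  assumes no: "\<And>\<kappa>. \<not> middle \<kappa>" and p: "p \<in> cycles_at w" and q: "q \<in> cycles_at w"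
  shows "p = q"
proof (rule ccontr)
  assume ne: "p \<noteq> q"
  obtain L L' where per: "periodic L p" "periodic L' q"
    using cycles_atD(3)[OF p] cycles_atD(3)[OF q] by blast
  have pts: "glue 0 q p \<in> points" "glue 0 p q \<in> points"
    using p q by (auto intro!: glue_points simp: cycles_at_def)
  have "glue 0 q p \<noteq> p"
  proof
    assume eq: "glue 0 q p = p"
    have "q = p"
    proof (rule periodic_eq_left[OF per(2,1)])
      fix t :: int assume "t < 0"
      then show "q t = p t" using fun_cong[OF eq, of t] by (simp add: glue_def)
    qed
    with ne show False by simp
  qed
  moreover have "right_tail (glue 0 q p) p"
    unfolding right_tail_def by (intro exI[of _ 0]) (simp add: glue_def)
  moreover have "glue 0 p q \<noteq> p"
  proof
    assume eq: "glue 0 p q = p"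
    have "q = p"
    proof (rule periodic_eq_right[OF per(2,1)])
      fix t :: int assume "0 \<le> t"
      then show "q t = p t" using fun_cong[OF eq, of t] by (simp add: glue_def)
    qed
    with ne show False by simp
  qed
  moreover have "left_tail (glue 0 p q) p"
    unfolding left_tail_def by (intro exI[of _ 0]) (simp add: glue_def)
  ultimately have "middle p"
    using pts per(1) cycles_atD(1)[OF p] unfolding middle_def by blast
  with no show False ..
qed

lemma finite_periodic_points_if_no_middle:
  assumes no: "\<And>\<kappa>. \<not> middle \<kappa>"
  shows "finite periodic_points"
proof (rule finite_subset)
  show "periodic_points \<subseteq> (\<Union>w\<in>vertices. cycles_at w)"
    using factor_in_vertices by (auto simp: periodic_points_def cycles_at_def)
  have "finite (cycles_at w)" for w
  proof (cases "cycles_at w = {}")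
    case False
    then obtain p where "p \<in> cycles_at w" by blast
    then have "cycles_at w \<subseteq> {p}"
      using unique_cycle_if_no_middle[OF no] by blast
    then show ?thesis by (rule finite_subset) simp
  qed simp
  then show "finite (\<Union>w\<in>vertices. cycles_at w)"
    using finite_vertices by blast
qed

text \<open>Among \<open>card vertices + 1\<close> consecutive positions some vertex repeats, which produces a cycle that
\<open>x\<close> follows for a while. As this cycle is not middle, either no other path falls into it, and \<open>x\<close>
has been on it for ever, or no other path leaves it, and \<open>x\<close> stays.\<close>

lemma tail_dichotomy_if_no_middle:
  assumes no: "\<And>\<kappa>. \<not> middle \<kappa>" and x: "x \<in> points"
  shows "(\<exists>\<kappa>\<in>periodic_points. \<forall>j<i. x j = \<kappa> j) \<or>
    (\<exists>\<kappa>\<in>periodic_points. \<forall>j\<ge>i + int (card vertices). x j = \<kappa> j)"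
proof -
  let ?I = "{i..i + int (card vertices)}"
  have sub: "(\<lambda>a. factor x a N) ` ?I \<subseteq> vertices"
    using factor_in_vertices[OF x] by blast
  have "\<not> inj_on (\<lambda>a. factor x a N) ?I"
  proof
    assume "inj_on (\<lambda>a. factor x a N) ?I"
    then have "card ?I \<le> card vertices"
      using sub finite_vertices by (rule card_inj_on_le)
    then show False by simp
  qed
  then obtain a b where ab: "i \<le> a" "a < b" "b \<le> i + int (card vertices)"
    "factor x a N = factor x b N"
    unfolding inj_on_def by (metis atLeastAtMost_iff linorder_neq_iff)
  obtain p where p: "p \<in> points" "periodic (b - a) p"
    "\<forall>j\<in>{0..<b - a + int N}. p j = translate a x j"
    by (rule closing[of "translate a x" "b - a"]) (use x ab in auto)
  define \<kappa> where "\<kappa> = translate (-a) p"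
  have \<kappa>: "\<kappa> \<in> periodic_points"
    unfolding \<kappa>_def using p by (intro translate_periodic_points) (auto simp: periodic_points_def)
  have eq: "factor x a N = factor \<kappa> a N"
    using p(3) ab(2) by (intro factor_cong) (simp add: \<kappa>_def translate_apply)
  have "\<kappa> \<in> points"
    using \<kappa> by (simp add: periodic_points_def)
  then have pts: "glue a x \<kappa> \<in> points" "glue a \<kappa> x \<in> points"
    using x eq by (simp_all add: glue_points)
  have tails: "right_tail (glue a x \<kappa>) \<kappa>" "left_tail (glue a \<kappa> x) \<kappa>"
    unfolding right_tail_def left_tail_def by (intro exI[of _ a]; simp add: glue_def)+
  consider "glue a x \<kappa> = \<kappa>" | "glue a \<kappa> x = \<kappa>"
    using no[of \<kappa>] \<kappa> pts tails unfolding middle_def periodic_points_def by blast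
  then show ?thesis
  proof cases
    case 1
    have "x j = \<kappa> j" if "j < i" for j
      using fun_cong[OF 1, of j] that ab(1) by (simp add: glue_def)
    with \<kappa> show ?thesis by blast
  next
    case 2
    have "x j = \<kappa> j" if "j \<ge> i + int (card vertices)" for j
      using fun_cong[OF 2, of j] that ab by (simp add: glue_def)
    with \<kappa> show ?thesis by blast
  qed
qed

text \<open>Every path is periodic on the left up to some position and periodic on the right after a bounded gap,
hence up to translation it is determined by two of the finitely many cycles and a word of bounded
length.\<close>

lemma finite_orbits_if_no_middle:
  assumes no: "\<And>\<kappa>. \<not> middle \<kappa>"
  obtains F where "finite F" "\<forall>x\<in>points. \<exists>k. translate k x \<in> F"
proof -
  define c where "c = card vertices"
  let ?W = "{w. set w \<subseteq> \<Union> (set ` A) \<and> length w = Suc c}"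
  define g :: "(int \<Rightarrow> int) \<times> (int \<Rightarrow> int) \<times> int list \<Rightarrow> int \<Rightarrow> int" where
    "g = (\<lambda>(\<kappa>, \<kappa>', w) j. if j < 0 then \<kappa> j else if j < int (Suc c) then w ! nat j else \<kappa>' j)"
  define F where "F = periodic_points \<union> g ` (periodic_points \<times> periodic_points \<times> ?W)"
  have "finite ?W"
    using finite_words by (intro finite_lists_length_eq) simp
  then have "finite F"
    unfolding F_def using finite_periodic_points_if_no_middle[OF no] by simp
  moreover have "\<forall>x\<in>points. \<exists>k. translate k x \<in> F"
  proof
    fix x assume x: "x \<in> points"
    define Lt where "Lt i \<longleftrightarrow> (\<exists>\<kappa>\<in>periodic_points. \<forall>j<i. x j = \<kappa> j)" for i
    define Rt where "Rt i \<longleftrightarrow> (\<exists>\<kappa>\<in>periodic_points. \<forall>j\<ge>i. x j = \<kappa> j)" for i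
    have dich: "Lt i \<or> Rt (i + int c)" for i
      unfolding Lt_def Rt_def c_def by (rule tail_dichotomy_if_no_middle[OF no x])
    consider "\<forall>i. Lt i" | "\<forall>i. Rt i" | i where "Lt i" "Rt (i + int (Suc c))"
    proof -
      have "\<exists>i. Lt i \<and> Rt (i + int (Suc c))" if "\<not> Lt i2" "\<not> Rt i1" for i1 i2
      proof -
        have "\<exists>i. Lt i \<and> \<not> Lt (i + 1)"
        proof (rule ccontr)
          assume *: "\<nexists>i. Lt i \<and> \<not> Lt (i + 1)"
          have start: "Lt (i1 - int c)"
            using dich[of "i1 - int c"] that(2) by simp
          have "Lt i" if "i1 - int c \<le> i" for i
            using that by (induction i rule: int_ge_induct) (use start * in auto)
          moreover have "Lt i" if "i \<le> i1 - int c" for i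
          proof -
            obtain \<kappa> where "\<kappa> \<in> periodic_points" "\<forall>j<i1 - int c. x j = \<kappa> j"
              using start unfolding Lt_def by blast
            moreover from this(2) have "\<forall>j<i. x j = \<kappa> j"
              using that by simp
            ultimately show ?thesis
              unfolding Lt_def by blast
          qed
          ultimately show False
            using that(1) by (metis linear)
        qed
        then obtain i where i: "Lt i" "\<not> Lt (i + 1)" by blast
        then have "Rt (i + 1 + int c)"
          using dich[of "i + 1"] by simp
        then have "Rt (i + int (Suc c))"
          by (simp add: add_ac)
        with i show ?thesis by blast
      qed
      then show thesis using that by blast
    qed
    then show "\<exists>k. translate k x \<in> F"
    proof cases
      case 1
      then obtain \<kappa> where \<kappa>: "\<kappa> \<in> periodic_points" "\<forall>j<0. x j = \<kappa> j"
        unfolding Lt_def by blast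
      have "x j = \<kappa> j" for j
      proof -
        obtain \<kappa>' where \<kappa>': "\<kappa>' \<in> periodic_points" "\<forall>i<max 0 (j + 1). x i = \<kappa>' i"
          using 1 unfolding Lt_def by blast
        obtain L L' where "periodic L \<kappa>" "periodic L' \<kappa>'"
          using \<kappa> \<kappa>' by (auto simp: periodic_points_def)
        then have "\<kappa> = \<kappa>'"
          by (rule periodic_eq_left[where a = 0]) (use \<kappa> \<kappa>' in \<open>metis less_max_iff_disj\<close>)
        then show ?thesis using \<kappa>' by simp
      qed
      then have "x = \<kappa>" by blast
      then have "translate 0 x \<in> F" using \<kappa> by (simp add: F_def)
      then show ?thesis ..
    next
      case 2
      then obtain \<kappa> where \<kappa>: "\<kappa> \<in> periodic_points" "\<forall>j\<ge>0. x j = \<kappa> j"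
        unfolding Rt_def by blast
      have "x j = \<kappa> j" for j
      proof -
        obtain \<kappa>' where \<kappa>': "\<kappa>' \<in> periodic_points" "\<forall>i\<ge>min 0 j. x i = \<kappa>' i"
          using 2 unfolding Rt_def by blast
        obtain L L' where "periodic L \<kappa>" "periodic L' \<kappa>'"
          using \<kappa> \<kappa>' by (auto simp: periodic_points_def)
        then have "\<kappa> = \<kappa>'"
          by (rule periodic_eq_right[where a = 0]) (use \<kappa> \<kappa>' in \<open>metis min.coboundedI1\<close>)
        then show ?thesis using \<kappa>' by simp
      qed
      then have "x = \<kappa>" by blast
      then have "translate 0 x \<in> F" using \<kappa> by (simp add: F_def)
      then show ?thesis ..
    next
      case 3
      then obtain \<kappa> \<kappa>' where \<kappa>: "\<kappa> \<in> periodic_points" "\<kappa>' \<in> periodic_points"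
        "\<forall>j<i. x j = \<kappa> j" "\<forall>j\<ge>i + int (Suc c). x j = \<kappa>' j"
        unfolding Lt_def Rt_def by blast
      let ?w = "factor x i (Suc c)"
      have "translate i x j = g (translate i \<kappa>, translate i \<kappa>', ?w) j" for j
        using \<kappa>(3,4) by (auto simp: g_def translate_apply factor_def add.commute simp del: upt_Suc)
      then have "translate i x = g (translate i \<kappa>, translate i \<kappa>', ?w)"
        by blast
      moreover have "?w \<in> ?W"
        using points_letters[OF x] by (auto simp: factor_def)
      ultimately have "translate i x \<in> F"
        unfolding F_def using translate_periodic_points[OF \<kappa>(1)] translate_periodic_points[OF \<kappa>(2)]
        by blast
      then show ?thesis ..
    qed
  qed
  ultimately show ?thesis by (rule that)
qed

end

section \<open>Sequences joining source cycles to sink cycles\<close>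

text \<open>A vertex with the fewest predecessors below \<open>v\<close> does the job.\<close>

lemma finite_preorder_minimal:
  assumes fin: "finite V" and dom: "\<And>u v. R u v \<Longrightarrow> u \<in> V"
    and refl: "\<And>v. v \<in> V \<Longrightarrow> R v v" and trans: "\<And>u v w. R u v \<Longrightarrow> R v w \<Longrightarrow> R u w"
    and v: "v \<in> V"
  obtains w where "w \<in> V" "R w v" "\<forall>u. R u w \<longrightarrow> R w u"
proof -
  let ?m = "\<lambda>w. card {u. R u w}"
  have fin': "finite {u. R u w}" for w
    by (rule finite_subset[OF _ fin]) (use dom in blast)
  obtain w where w: "R w v" "\<And>y. R y v \<Longrightarrow> ?m w \<le> ?m y"
    using ex_has_least_nat[of "\<lambda>w. R w v" v ?m] refl[OF v] by blast
  have "R w u" if "R u w" for u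
  proof -
    have sub: "{t. R t u} \<subseteq> {t. R t w}"
      using trans that by blast
    moreover have "?m w \<le> ?m u"
      using w that trans by blast
    ultimately have "{t. R t u} = {t. R t w}"
      using card_seteq[OF fin'] by blast
    then show ?thesis
      using refl[OF dom[OF w(1)]] by blast
  qed
  with w(1) dom that show ?thesis by blast
qed

text \<open>The ends \<open>l\<close> and \<open>r\<close> are not normalised to a phase: they agree with \<open>y\<close> at the same positions.\<close>

definition connects :: "(int \<Rightarrow> int) \<Rightarrow> (int \<Rightarrow> int) \<Rightarrow> (int \<Rightarrow> int) \<Rightarrow> bool" where
  "connects y l r \<longleftrightarrow> (\<exists>L. periodic L l) \<and> (\<exists>L. periodic L r) \<and> left_tail y l \<and> right_tail y r"

lemma left_tail_unique:
  assumes "left_tail x p" "left_tail x q" "periodic L p" "periodic L' q"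
  shows "p = q"
proof -
  obtain a b where "\<forall>j<a. x j = p j" "\<forall>j<b. x j = q j"
    using assms(1,2) unfolding left_tail_def by blast
  then show ?thesis
    using assms(3,4) by (intro periodic_eq_left[of L p L' q "min a b"]) (metis min_less_iff_conj)+
qed

lemma right_tail_unique:
  assumes "right_tail x p" "right_tail x q" "periodic L p" "periodic L' q"
  shows "p = q"
proof -
  obtain a b where "\<forall>j\<ge>a. x j = p j" "\<forall>j\<ge>b. x j = q j"
    using assms(1,2) unfolding right_tail_def by blast
  then show ?thesis
    using assms(3,4) by (intro periodic_eq_right[of L p L' q "max a b"]) (metis max.bounded_iff)+
qed

lemma connects_unique:
  assumes "connects y l r" "connects y l' r'"
  shows "l = l' \<and> r = r'"
  using assms left_tail_unique right_tail_unique unfolding connects_def by blast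

lemma factor_right_tail:
  assumes "right_tail x p" "periodic L p"
  shows "\<exists>j. factor p i n = factor x j n"
proof -
  obtain a where a: "\<forall>j\<ge>a. x j = p j" using assms(1) by (auto simp: right_tail_def)
  have "a - i \<le> 1 * \<bar>a - i\<bar>" by simp
  also have "\<dots> \<le> L * \<bar>a - i\<bar>"
    using periodic_pos[OF assms(2)] by (intro mult_right_mono) simp_all
  finally have ge: "a \<le> i + L * \<bar>a - i\<bar>" by simp
  have "factor p i n = factor x (i + L * \<bar>a - i\<bar>) n"
  proof (rule factor_eqI)
    fix t assume "i \<le> t" "t < i + int n"
    then have "x (t + L * \<bar>a - i\<bar>) = p (t + L * \<bar>a - i\<bar>)"
      using a ge by simp
    then show "p t = x (t - i + (i + L * \<bar>a - i\<bar>))"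
      using periodic_add_mult[OF assms(2)] by simp
  qed
  then show ?thesis ..
qed

lemma left_tail_cong:
  assumes "\<forall>j<i. y j = x j"
  shows "left_tail y p \<longleftrightarrow> left_tail x p"
proof
  assume "left_tail y p"
  then obtain a where "\<forall>j<a. y j = p j" by (auto simp: left_tail_def)
  then show "left_tail x p"
    unfolding left_tail_def using assms by (intro exI[of _ "min a i"]) (metis min_less_iff_conj)
next
  assume "left_tail x p"
  then obtain a where "\<forall>j<a. x j = p j" by (auto simp: left_tail_def)
  then show "left_tail y p"
    unfolding left_tail_def using assms by (intro exI[of _ "min a i"]) (metis min_less_iff_conj)
qed

context sft
begin

text \<open>Vertices of the strongly connected components that no path enters, respectively leaves.\<close>

definition initial :: "int list \<Rightarrow> bool" where
  "initial w \<longleftrightarrow> w \<in> vertices \<and> (\<forall>u. reach u w \<longrightarrow> reach w u)"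

definition terminal :: "int list \<Rightarrow> bool" where
  "terminal w \<longleftrightarrow> w \<in> vertices \<and> (\<forall>u. reach w u \<longrightarrow> reach u w)"

lemma exists_initial:
  assumes "v \<in> vertices"
  obtains w where "initial w" "reach w v"
proof -
  obtain w where "w \<in> vertices" "reach w v" "\<forall>u. reach u w \<longrightarrow> reach w u"
  proof (rule finite_preorder_minimal[OF finite_vertices, of reach v])
    show "reach u w" if "reach u v" "reach v w" for u v w
      using that by (rule reach_trans)
  qed (use assms reach_vertices reach_refl in \<open>blast+\<close>)
  with that show ?thesis by (simp add: initial_def)
qed

lemma exists_terminal:
  assumes "v \<in> vertices"
  obtains w where "terminal w" "reach v w"
proof -
  obtain w where "w \<in> vertices" "reach v w" "\<forall>u. reach w u \<longrightarrow> reach u w"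
  proof (rule finite_preorder_minimal[OF finite_vertices, of "\<lambda>a b. reach b a" v])
    show "reach w u" if "reach v u" "reach w v" for u v w
      using that(2,1) by (rule reach_trans)
  qed (use assms reach_vertices reach_refl in \<open>blast+\<close>)
  with that show ?thesis by (simp add: terminal_def)
qed

lemma cycles_at_initial:
  assumes "initial w"
  obtains p where "p \<in> cycles_at w"
proof -
  obtain x where x: "x \<in> points" "factor x 0 N = w"
    using assms by (auto simp: initial_def vertices_def)
  let ?x = "translate (-1) x"
  have "?x \<in> points" using x by simp
  moreover have "reach (factor ?x 1 N) (factor ?x 0 N)"
    using assms x reachI[OF x(1), of "-1" 0] by (simp add: initial_def)
  ultimately obtain p where p: "p \<in> cycles_at (factor ?x 0 N)" "\<forall>j\<in>{0..<1 + int N}. p j = ?x j"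
    using closing_reach[of ?x 1] by auto
  have "factor (translate 1 p) 0 N = factor x 0 N"
    using p(2) by (intro factor_cong) (simp add: translate_apply)
  then have "translate 1 p \<in> cycles_at w"
    using x(2) cycles_atD(1,3)[OF p(1)] periodic_translate by (auto simp: cycles_at_def)
  with that show ?thesis .
qed

lemma cycles_at_terminal:
  assumes "terminal w"
  obtains p where "p \<in> cycles_at w"
proof -
  obtain x where x: "x \<in> points" "factor x 0 N = w"
    using assms by (auto simp: terminal_def vertices_def)
  then have "reach (factor x 1 N) (factor x 0 N)"
    using assms reachI[OF x(1), of 0 1] by (auto simp: terminal_def)
  then obtain p where "p \<in> cycles_at (factor x 0 N)"
    using closing_reach[OF x(1), of 1] by auto
  with x that show ?thesis by simp
qed

text \<open>If the initial component of \<open>w\<close> carries only the cycle \<open>p\<close>, then the component is that cycle, and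
whatever ends on it has always been on it.\<close>

lemma initial_absorbs:
  assumes w: "initial w" "cycles_at w \<subseteq> {p}" and \<kappa>: "\<kappa> \<in> orbit p" "p \<in> cycles_at w"
    and u: "u \<in> points" "right_tail u \<kappa>"
  shows "u = \<kappa>"
proof -
  obtain L where L: "periodic L p" using cycles_atD(3)[OF \<kappa>(2)] by blast
  obtain s where s: "\<kappa> = translate s p" using \<kappa>(1) by (rule orbitE)
  obtain a where a: "\<forall>j\<ge>a. u j = \<kappa> j" using u(2) by (auto simp: right_tail_def)
  \<comment> \<open>A position in the tail of \<open>u\<close> at which \<open>\<kappa>\<close> has the phase of \<open>p\<close>.\<close>
  define i where "i = L * \<bar>a + s\<bar> - s"
  have "1 * \<bar>a + s\<bar> \<le> L * \<bar>a + s\<bar>"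
    using periodic_pos[OF L] by (intro mult_right_mono) simp_all
  then have "a \<le> i" by (simp add: i_def)
  have \<kappa>_eq: "\<kappa> j = p (j - i)" for j
  proof -
    have "\<kappa> j = p (j + s)" by (simp add: s translate_apply)
    also have "\<dots> = p (j + s + L * (- \<bar>a + s\<bar>))"
      by (rule periodic_add_mult[OF L, symmetric])
    finally show ?thesis by (simp add: i_def algebra_simps)
  qed
  let ?x = "translate i u"
  have "factor ?x 0 N = factor p 0 N"
    using a \<open>a \<le> i\<close> by (intro factor_cong) (simp add: translate_apply \<kappa>_eq)
  then have x0: "factor ?x 0 N = w"
    using cycles_atD(2)[OF \<kappa>(2)] by simp
  have x: "?x \<in> points" using u by simp
  have "u j = \<kappa> j" if "j < i" for j
  proof -
    have "reach (factor ?x (j - i) N) (factor ?x 0 N)"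
      using that by (intro reachI x) simp
    then have "reach (factor ?x 0 N) (factor ?x (- (i - j)) N)"
      using w(1) x0 by (simp add: initial_def)
    then have "?x (j - i) = p (j - i)"
      by (rule unique_cycle_left[OF x, of "i - j", rotated]) (use that w(2) x0 in auto)
    then show ?thesis by (simp add: \<kappa>_eq translate_apply)
  qed
  moreover have "u j = \<kappa> j" if "j \<ge> i" for j
    using that \<open>a \<le> i\<close> a by simp
  ultimately have "u j = \<kappa> j" for j by (meson linorder_not_le)
  then show ?thesis by blast
qed

lemma terminal_absorbs:
  assumes w: "terminal w" "cycles_at w \<subseteq> {p}" and \<kappa>: "\<kappa> \<in> orbit p" "p \<in> cycles_at w"
    and v: "v \<in> points" "left_tail v \<kappa>"
  shows "v = \<kappa>"
proof -
  obtain L where L: "periodic L p" using cycles_atD(3)[OF \<kappa>(2)] by blast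
  obtain s where s: "\<kappa> = translate s p" using \<kappa>(1) by (rule orbitE)
  obtain a where a: "\<forall>j<a. v j = \<kappa> j" using v(2) by (auto simp: left_tail_def)
  \<comment> \<open>A position so far left that the whole window at \<open>i\<close> lies in the tail of \<open>v\<close>.\<close>
  define i where "i = - (L * (\<bar>a + s\<bar> + int N)) - s"
  have "1 * (\<bar>a + s\<bar> + int N) \<le> L * (\<bar>a + s\<bar> + int N)"
    using periodic_pos[OF L] by (intro mult_right_mono) simp_all
  then have "i + int N \<le> a" by (simp add: i_def)
  have \<kappa>_eq: "\<kappa> j = p (j - i)" for j
  proof -
    have "\<kappa> j = p (j + s)" by (simp add: s translate_apply)
    also have "\<dots> = p (j + s + L * (\<bar>a + s\<bar> + int N))"
      by (rule periodic_add_mult[OF L, symmetric])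
    finally show ?thesis by (simp add: i_def algebra_simps)
  qed
  let ?x = "translate i v"
  have "factor ?x 0 N = factor p 0 N"
    using a \<open>i + int N \<le> a\<close> by (intro factor_cong) (simp add: translate_apply \<kappa>_eq)
  then have x0: "factor ?x 0 N = w"
    using cycles_atD(2)[OF \<kappa>(2)] by simp
  have x: "?x \<in> points" using v by simp
  have "v j = \<kappa> j" if "j \<ge> i" for j
  proof -
    have "reach (factor ?x 0 N) (factor ?x (j - i + 1) N)"
      using that by (intro reachI x) simp
    then have "reach (factor ?x (j - i + 1) N) (factor ?x 0 N)"
      using w(1) x0 by (simp add: terminal_def)
    then have "?x (j - i) = p (j - i)"
      by (rule unique_cycle_right[OF x, of "j - i + 1", rotated]) (use that w(2) x0 in auto)
    then show ?thesis by (simp add: \<kappa>_eq translate_apply)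
  qed
  moreover have "v j = \<kappa> j" if "j < i" for j
    using that \<open>i + int N \<le> a\<close> a by simp
  ultimately have "v j = \<kappa> j" for j by (meson linorder_not_le)
  then show ?thesis by blast
qed

text \<open>If all cycles through \<open>w\<close> were translates of \<open>\<kappa>\<close>, there would be finitely many, hence only one, and
no other path could fall into \<open>\<kappa>\<close>.\<close>

lemma exists_source:
  assumes "middle \<kappa>" "initial w"
  obtains p where "p \<in> cycles_at w" "p \<notin> orbit \<kappa>"
proof -
  obtain p where p: "p \<in> cycles_at w"
    using cycles_at_initial[OF assms(2)] .
  have fin: "finite (orbit \<kappa>)"
    using assms(1) finite_orbit by (auto simp: middle_def)
  obtain u where u: "u \<in> points" "u \<noteq> \<kappa>" "right_tail u \<kappa>"
    using assms(1) by (auto simp: middle_def)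
  have "\<not> cycles_at w \<subseteq> orbit \<kappa>"
  proof
    assume sub: "cycles_at w \<subseteq> orbit \<kappa>"
    then have "finite (cycles_at w)" using fin by (rule finite_subset)
    then have "cycles_at w \<subseteq> {p}" using infinite_cycles_at[OF p] by blast
    moreover have "\<kappa> \<in> orbit p" using sub p orbit_sym by blast
    ultimately have "u = \<kappa>" using initial_absorbs[OF assms(2)] p u by blast
    with u(2) show False ..
  qed
  with that show ?thesis by blast
qed

text \<open>The set \<open>F\<close> will consist of the sources. It can be avoided unless \<open>q\<close> is the only cycle through \<open>w\<close>,
as happens in a component that is a single cycle without any connection to the rest of the graph.\<close>

lemma exists_sink:
  assumes "middle \<kappa>" "terminal w" and F: "finite F"
  obtains q where "q \<in> cycles_at w" "q \<notin> orbit \<kappa>" "q \<in> F \<longrightarrow> cycles_at w \<subseteq> {q}"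
proof -
  obtain p where p: "p \<in> cycles_at w"
    using cycles_at_terminal[OF assms(2)] .
  have fin: "finite (orbit \<kappa>)"
    using assms(1) finite_orbit by (auto simp: middle_def)
  obtain v where v: "v \<in> points" "v \<noteq> \<kappa>" "left_tail v \<kappa>"
    using assms(1) by (auto simp: middle_def)
  show ?thesis
  proof (cases "finite (cycles_at w)")
    case False
    then have "\<not> cycles_at w \<subseteq> orbit \<kappa> \<union> F"
      using fin F finite_subset by blast
    with that show ?thesis by blast
  next
    case True
    then have sub: "cycles_at w \<subseteq> {p}" using infinite_cycles_at[OF p] by blast
    have "p \<notin> orbit \<kappa>"
    proof
      assume "p \<in> orbit \<kappa>"
      then have "\<kappa> \<in> orbit p" by (rule orbit_sym)
      then have "v = \<kappa>" using terminal_absorbs[OF assms(2) sub] p v by blast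
      with v(2) show False ..
    qed
    with sub p that show ?thesis by blast
  qed
qed

text \<open>Only the part of \<open>x\<close> to the left of \<open>i\<close> is changed: it becomes a path that comes from the cycle \<open>p\<close>.\<close>

lemma replace_left:
  assumes x: "x \<in> points" and r: "reach w (factor x i N)" and p: "p \<in> cycles_at w"
  obtains y p' where "y \<in> points" "\<forall>j\<ge>i. y j = x j" "p' \<in> orbit p" "left_tail y p'"
proof -
  obtain z k where z: "z \<in> points" "0 \<le> k" "factor z 0 N = w" "factor z k N = factor x i N"
    using r by (auto simp: reach_def)
  let ?z = "translate (k - i) z"
  let ?y1 = "glue i ?z x"
  have eq1: "factor ?z i N = factor x i N"
    using z by simp
  have y1: "?y1 \<in> points"
    using z x eq1 by (intro glue_points) simp_all
  let ?p = "translate (k - i) p"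
  have "factor ?y1 (i - k) N = factor ?z (i - k) N"
    using z(2) by (intro factor_cong glue_left_overlap[OF eq1]) simp
  then have eq2: "factor ?p (i - k) N = factor ?y1 (i - k) N"
    using z(3) cycles_atD(2)[OF p] by simp
  let ?y = "glue (i - k) ?p ?y1"
  have "?y \<in> points"
    using cycles_atD(1)[OF p] by (intro glue_points[OF _ y1 eq2]) simp
  moreover have "\<forall>j\<ge>i. ?y j = x j"
    using z(2) by (simp add: glue_def)
  moreover have "left_tail ?y ?p"
    unfolding left_tail_def by (intro exI[of _ "i - k"]) (simp add: glue_def)
  ultimately show ?thesis using that[of ?y ?p] by simp
qed

lemma replace_right:
  assumes x: "x \<in> points" and r: "reach (factor x i N) w" and q: "q \<in> cycles_at w"
  obtains y q' where "y \<in> points" "\<forall>j<i + int N. y j = x j" "q' \<in> orbit q" "right_tail y q'"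
proof -
  obtain z k where z: "z \<in> points" "i \<le> k" "\<forall>j<i + int N. z j = x j" "factor z k N = w"
    by (rule reach_join[OF x r])
  let ?q = "translate (-k) q"
  let ?y = "glue k z ?q"
  have eq: "factor z k N = factor ?q k N"
    using z cycles_atD(2)[OF q] by simp
  have "?y \<in> points"
    using z eq cycles_atD(1)[OF q] by (intro glue_points) simp_all
  moreover have "\<forall>j<i + int N. ?y j = x j"
    using glue_left_overlap[OF eq] z by simp
  moreover have "right_tail ?y ?q"
    unfolding right_tail_def by (intro exI[of _ k]) (simp add: glue_def)
  ultimately show ?thesis using that[of ?y ?q] by simp
qed

text \<open>Fix periodic sources, one for each initial vertex, and periodic sinks, one for each terminal vertex,
outside the orbit of \<open>\<kappa>\<close>; a sink is taken outside the orbits of the sources whenever there are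
infinitely many choices for it. Every arc lies on a path that comes from a source and ends in a sink;
moreover there are a path \<open>u\<close> from a source to \<open>\<kappa>\<close> and a path \<open>v\<close> from \<open>\<kappa>\<close> to a
sink. The rank (0 for sources, 1 for \<open>\<kappa>\<close>, 2 for sinks) rises strictly along each of them, so the
only cycle that is reached and left again is \<open>\<kappa>\<close>. The exception \<open>y = l\<close> accounts for components that
are a single cycle, where source and sink coincide.\<close>

lemma connecting_points:
  assumes mid: "middle \<kappa>"
    and ext: "\<And>w. w \<in> A \<Longrightarrow> \<exists>x\<in>points. \<exists>i. factor x i (Suc N) = w"
  obtains rank :: "(int \<Rightarrow> int) \<Rightarrow> nat" and E u v where
    "\<forall>t k. rank (translate k t) = rank t" "\<forall>t. rank t \<le> 2" "\<forall>t. rank t = 1 \<longleftrightarrow> t \<in> orbit \<kappa>"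
    "finite E" "E \<subseteq> points" "\<forall>w\<in>A. \<exists>y\<in>E. \<exists>i. factor y i (Suc N) = w"
    "\<forall>y\<in>E. \<exists>l r. connects y l r \<and> rank l \<noteq> 1 \<and> rank r \<noteq> 1 \<and> (y = l \<or> rank l < rank r)"
    "u \<in> points" "\<exists>l. connects u l \<kappa> \<and> rank l = 0"
    "v \<in> points" "\<exists>r. connects v \<kappa> r \<and> rank r = 2"
proof -
  have \<kappa>: "\<kappa> \<in> points" "\<exists>L. periodic L \<kappa>"
    using mid by (auto simp: middle_def)
  have "\<forall>w\<in>Collect initial. \<exists>p. p \<in> cycles_at w \<and> p \<notin> orbit \<kappa>"
  proof
    fix w assume "w \<in> Collect initial"
    then show "\<exists>p. p \<in> cycles_at w \<and> p \<notin> orbit \<kappa>"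
      by (auto intro: exists_source[OF mid])
  qed
  from bchoice[OF this] obtain src where src: "\<And>w. initial w \<Longrightarrow> src w \<in> cycles_at w"
    "\<And>w. initial w \<Longrightarrow> src w \<notin> orbit \<kappa>"
    by auto
  define P where "P = (\<Union>w\<in>Collect initial. orbit (src w))"
  have "finite (Collect initial)"
    by (rule finite_subset[OF _ finite_vertices]) (auto simp: initial_def)
  then have fP: "finite P"
    unfolding P_def using src(1) cycles_atD(3) finite_orbit by blast
  have "\<forall>w\<in>Collect terminal. \<exists>q. q \<in> cycles_at w \<and> q \<notin> orbit \<kappa> \<and>
      (q \<in> P \<longrightarrow> cycles_at w \<subseteq> {q})"
  proof
    fix w assume "w \<in> Collect terminal"
    then have w: "terminal w" by simp
    show "\<exists>q. q \<in> cycles_at w \<and> q \<notin> orbit \<kappa> \<and> (q \<in> P \<longrightarrow> cycles_at w \<subseteq> {q})"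
      by (rule exists_sink[OF mid w fP]) blast
  qed
  from bchoice[OF this] obtain snk where snk: "\<And>w. terminal w \<Longrightarrow> snk w \<in> cycles_at w"
    "\<And>w. terminal w \<Longrightarrow> snk w \<notin> orbit \<kappa>"
    "\<And>w. terminal w \<Longrightarrow> snk w \<in> P \<Longrightarrow> cycles_at w \<subseteq> {snk w}"
    by auto
  define Q where "Q = (\<Union>w\<in>Collect terminal. orbit (snk w))"
  have P_notin: "l \<notin> orbit \<kappa>" if "l \<in> P" for l
    using that src(2) orbit_sym orbit_trans unfolding P_def by blast
  have Q_notin: "r \<notin> orbit \<kappa>" if "r \<in> Q" for r
    using that snk(2) orbit_sym orbit_trans unfolding Q_def by blast
  define rank :: "(int \<Rightarrow> int) \<Rightarrow> nat" where
    "rank t = (if t \<in> orbit \<kappa> then 1 else if t \<in> Q then 2 else 0)" for t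
  have P_orbit: "t' \<in> P" if "t \<in> P" "t' \<in> orbit t" for t t'
    using that orbit_trans unfolding P_def by blast
  have P_per: "\<exists>L. periodic L l" if "l \<in> P" for l
    using that src(1) cycles_atD(3) periodic_orbit unfolding P_def by blast
  have Q_per: "\<exists>L. periodic L l" if "l \<in> Q" for l
    using that snk(1) cycles_atD(3) periodic_orbit unfolding Q_def by blast
  \<comment> \<open>A source that is also a sink is the only cycle of a terminal component, so nothing leaves it.\<close>
  have leave: "rank l = 0 \<or> y = l" if "y \<in> points" "left_tail y l" "l \<in> P" for y l
  proof (cases "l \<in> Q")
    case True
    then obtain w where w: "terminal w" "l \<in> orbit (snk w)"
      by (auto simp: Q_def)
    then have "snk w \<in> P"
      using P_orbit[OF that(3)] orbit_sym by blast
    then have "y = l"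
      using terminal_absorbs[OF w(1) snk(3)[OF w(1)] w(2) snk(1)[OF w(1)] that(1,2)] w(1) by simp
    then show ?thesis ..
  next
    case False
    then show ?thesis using P_notin[OF that(3)] by (simp add: rank_def)
  qed
  have left: "\<exists>y l. y \<in> points \<and> (\<forall>j\<ge>i. y j = x j) \<and> l \<in> P \<and> left_tail y l"
    if x: "x \<in> points" for x i
  proof -
    obtain w where w: "initial w" "reach w (factor x i N)"
      using exists_initial[OF factor_in_vertices[OF x]] .
    obtain y l where y: "y \<in> points" "\<forall>j\<ge>i. y j = x j" "l \<in> orbit (src w)" "left_tail y l"
      by (rule replace_left[OF x w(2) src(1)[OF w(1)]])
    then have "l \<in> P" using w(1) by (auto simp: P_def)
    with y show ?thesis by blast
  qed
  have right: "\<exists>y r. y \<in> points \<and> (\<forall>j<i + int N. y j = x j) \<and> r \<in> Q \<and> right_tail y r"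
    if x: "x \<in> points" for x i
  proof -
    obtain w where w: "terminal w" "reach (factor x i N) w"
      using exists_terminal[OF factor_in_vertices[OF x]] .
    obtain y r where y: "y \<in> points" "\<forall>j<i + int N. y j = x j" "r \<in> orbit (snk w)" "right_tail y r"
      by (rule replace_right[OF x w(2) snk(1)[OF w(1)]])
    then have "r \<in> Q" using w(1) by (auto simp: Q_def)
    with y show ?thesis by blast
  qed
  have "\<forall>w\<in>A. \<exists>y. y \<in> points \<and> (\<exists>i. factor y i (Suc N) = w) \<and>
     (\<exists>l r. connects y l r \<and> rank l \<noteq> 1 \<and> rank r \<noteq> 1 \<and> (y = l \<or> rank l < rank r))"
  proof
    fix w assume "w \<in> A"
    then obtain x i where x: "x \<in> points" "factor x i (Suc N) = w"
      using ext by blast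
    obtain y l where y: "y \<in> points" "\<forall>j\<ge>i. y j = x j" "l \<in> P" "left_tail y l"
      using left[OF x(1)] by blast
    obtain z r where z: "z \<in> points" "\<forall>j<i + 1 + int N. z j = y j" "r \<in> Q" "right_tail z r"
      using right[OF y(1)] by blast
    have "factor z i (Suc N) = w"
      unfolding x(2)[symmetric] using z(2) y(2) by (intro factor_cong) simp
    moreover have lt: "left_tail z l"
      using y(4) left_tail_cong[OF z(2)] by simp
    moreover have "rank r = 2"
      using z(3) Q_notin by (simp add: rank_def)
    moreover have "z = l \<or> rank l < rank r"
      using leave[OF z(1) lt y(3)] \<open>rank r = 2\<close> by auto
    moreover have "rank l \<noteq> 1"
      using P_notin[OF y(3)] by (simp add: rank_def)
    moreover have "connects z l r"
      unfolding connects_def using lt z(4) P_per[OF y(3)] Q_per[OF z(3)] by blast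
    ultimately show "\<exists>y. y \<in> points \<and> (\<exists>i. factor y i (Suc N) = w) \<and>
     (\<exists>l r. connects y l r \<and> rank l \<noteq> 1 \<and> rank r \<noteq> 1 \<and> (y = l \<or> rank l < rank r))"
      using z(1) by (intro exI[of _ z] conjI exI[of _ l] exI[of _ r]) auto
  qed
  from bchoice[OF this] obtain f where f: "\<And>w. w \<in> A \<Longrightarrow> f w \<in> points \<and> (\<exists>i. factor (f w) i (Suc N) = w) \<and>
     (\<exists>l r. connects (f w) l r \<and> rank l \<noteq> 1 \<and> rank r \<noteq> 1 \<and> (f w = l \<or> rank l < rank r))"
    by blast
  obtain u l where u: "u \<in> points" "\<forall>j\<ge>0. u j = \<kappa> j" "l \<in> P" "left_tail u l"
    using left[OF \<kappa>(1)] by blast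
  have rt: "right_tail u \<kappa>" using u(2) by (auto simp: right_tail_def)
  have "u \<noteq> l"
  proof
    assume "u = l"
    obtain L L' where "periodic L u" "periodic L' \<kappa>"
      using P_per[OF u(3)] \<kappa>(2) \<open>u = l\<close> by blast
    then have "u = \<kappa>" by (rule periodic_eq_right[where a = 0]) (use u(2) in blast)
    with \<open>u = l\<close> P_notin[OF u(3)] show False by simp
  qed
  then have "rank l = 0"
    using leave[OF u(1,4,3)] by simp
  moreover have "connects u l \<kappa>"
    unfolding connects_def using rt u(4) \<kappa>(2) P_per[OF u(3)] by simp
  ultimately have u': "\<exists>l. connects u l \<kappa> \<and> rank l = 0"
    by blast
  obtain v r where v: "v \<in> points" "\<forall>j<0 + int N. v j = \<kappa> j" "r \<in> Q" "right_tail v r"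
    using right[OF \<kappa>(1)] by blast
  have "left_tail v \<kappa>" using v(2) by (auto simp: left_tail_def)
  moreover have "rank r = 2" using v(3) Q_notin by (simp add: rank_def)
  ultimately have v': "connects v \<kappa> r \<and> rank r = 2"
    using v(4) \<kappa>(2) Q_per[OF v(3)] by (simp add: connects_def)
  have "translate k t \<in> Q \<longleftrightarrow> t \<in> Q" for k t
    by (simp add: Q_def)
  then have rank_tr: "\<forall>t k. rank (translate k t) = rank t"
    by (simp only: rank_def translate_in_orbit_iff) simp
  show ?thesis
  proof (rule that[of rank "f ` A" u v])
    show "\<forall>t. rank t \<le> 2" "\<forall>t. (rank t = 1) = (t \<in> orbit \<kappa>)"
      by (simp_all add: rank_def)
    show "finite (f ` A)" using finite_words by simp
    show "\<forall>w\<in>A. \<exists>y\<in>f ` A. \<exists>i. factor y i (Suc N) = w"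
      "f ` A \<subseteq> points"
      "\<forall>y\<in>f ` A. \<exists>l r. connects y l r \<and> rank l \<noteq> 1 \<and> rank r \<noteq> 1 \<and> (y = l \<or> rank l < rank r)"
      using f by blast+
    show "\<exists>r. connects v \<kappa> r \<and> rank r = 2" using v' by blast
  qed (rule rank_tr u' u(1) v(1))+
qed

end

section \<open>The Rauzy graph of finitely many joined cycles\<close>

text \<open>For a periodic \<open>x\<close> these are the vertices, respectively the arcs, of the closed path that \<open>x\<close> traces
in a Rauzy graph.\<close>

definition factors_of :: "(int \<Rightarrow> int) \<Rightarrow> nat \<Rightarrow> int list set" where
  "factors_of x n = range (\<lambda>i. factor x i n)"

lemma factors_of_orbit: "y \<in> orbit x \<Longrightarrow> factors_of y n = factors_of x n"
proof -
  have *: "factors_of (translate k x) n \<subseteq> factors_of x n" for k x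
    by (auto simp: factors_of_def)
  assume "y \<in> orbit x"
  then obtain k where "y = translate k x" by (rule orbitE)
  then have "x = translate (-k) y" by simp
  with \<open>y = translate k x\<close> show ?thesis using * by (metis subset_antisym)
qed

lemma butlast_in_language: "w \<in> language (Suc n) X \<Longrightarrow> butlast w \<in> language n X"
  by (fastforce simp: language_eq_factors butlast_factor)

text \<open>A path in a Rauzy graph is spelled out by the first letters of its arcs.\<close>

lemma chain_eq_factor:
  assumes len: "\<And>i. length (f i) = m" and chain: "\<And>i. tl (f i) = butlast (f (i + 1))"
  shows "f i = factor (\<lambda>j. hd (f j)) i m"
proof -
  have nth: "f i ! k = hd (f (i + int k))" if "k < m" for i k
    using that
  proof (induction k arbitrary: i)
    case 0
    then show ?case using len[of i] by (cases "f i") auto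
  next
    case (Suc k)
    have "f i ! Suc k = tl (f i) ! k"
      using Suc.prems len[of i] by (simp add: nth_tl)
    also have "\<dots> = f (i + 1) ! k"
      using Suc.prems len[of "i + 1"] by (simp add: chain nth_butlast)
    also have "\<dots> = hd (f (i + 1 + int k))"
      using Suc by simp
    finally show ?case by (simp add: add_ac)
  qed
  show ?thesis
    by (rule nth_equalityI) (simp_all add: len nth factor_def)
qed

lemma cas_consecutive:
  assumes "pre_digraph.cas G u p v"
  shows "Suc i < length p \<Longrightarrow> head G (p ! i) = tail G (p ! Suc i)"
    and "p \<noteq> [] \<Longrightarrow> tail G (p ! 0) = u \<and> head G (last p) = v"
  using assms
proof (induction p arbitrary: u i)
  case (Cons e p)
  {
    case 1
    then show ?case
      using Cons.IH(1)[of "i - 1" "head G e"] Cons.IH(2)[of "head G e"]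
      by (cases i; cases p) (auto simp: pre_digraph.cas.simps)
  next
    case 2
    then show ?case
      using Cons.IH(2)[of "head G e"] by (cases p) (auto simp: pre_digraph.cas.simps)
  }
qed simp_all

lemma rauzy_cycle_periodic:
  assumes "K \<in> simple_cycles (rauzy_graph X m)"
  obtains z L where "periodic L z" "K = factors_of z m"
proof -
  obtain p u where p: "K = set p" "pre_digraph.awalk (rauzy_graph X m) u p u" "p \<noteq> []"
    using assms by (auto simp: simple_cycles_def pre_digraph.cycle_def)
  have cas: "pre_digraph.cas (rauzy_graph X m) u p u" and sub: "set p \<subseteq> language m X"
    using p(2) by (auto simp: pre_digraph.awalk_def rauzy_graph_def)
  define n where "n = int (length p)"
  have n: "0 < n" using p(3) by (simp add: n_def)
  define f where "f i = p ! nat (i mod n)" for i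
  have idx: "nat (i mod n) < length p" for i
    using n pos_mod_bound[OF n, of i] pos_mod_sign[OF n, of i] unfolding n_def by linarith
  have len: "length (f i) = m" for i
  proof -
    have "f i \<in> language m X"
      using sub nth_mem[OF idx[of i]] by (auto simp: f_def)
    then show ?thesis by (auto simp: language_eq_factors)
  qed
  have chain: "tl (f i) = butlast (f (i + 1))" for i
  proof (cases "i mod n = n - 1")
    case True
    then have "(i + 1) mod n = 0"
      by (metis diff_add_cancel mod_add_left_eq mod_self)
    moreover have "p ! nat (n - 1) = last p"
      using p(3) by (simp add: n_def last_conv_nth nat_diff_distrib')
    ultimately show ?thesis
      using cas_consecutive(2)[OF cas p(3)] True by (simp add: f_def rauzy_graph_def)
  next
    case False
    then have lt: "i mod n + 1 < n"
      using pos_mod_bound[OF n, of i] by linarith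
    have "(i + 1) mod n = (i mod n + 1) mod n"
      by (simp add: mod_add_left_eq)
    also have "\<dots> = i mod n + 1"
      using lt pos_mod_sign[OF n, of i] by (intro mod_pos_pos_trivial) linarith+
    finally have "nat ((i + 1) mod n) = Suc (nat (i mod n))"
      using pos_mod_sign[OF n, of i] by (simp add: nat_add_distrib)
    moreover have "Suc (nat (i mod n)) < length p"
      using lt pos_mod_sign[OF n, of i] unfolding n_def by linarith
    ultimately show ?thesis
      using cas_consecutive(1)[OF cas, of "nat (i mod n)"] by (simp add: f_def rauzy_graph_def)
  qed
  define z where "z = (\<lambda>j. hd (f j))"
  have fz: "f i = factor z i m" for i
    unfolding z_def using len chain by (rule chain_eq_factor)
  have "periodic n z"
    using n by (simp add: periodic_def z_def f_def)
  moreover have "K = factors_of z m"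
  proof
    show "K \<subseteq> factors_of z m"
    proof
      fix w assume "w \<in> K"
      then obtain i where "i < length p" "w = p ! i"
        using p(1) by (metis in_set_conv_nth)
      then have "w = f (int i)" by (simp add: f_def n_def)
      then show "w \<in> factors_of z m" using fz by (simp add: factors_of_def)
    qed
    show "factors_of z m \<subseteq> K"
      using idx by (auto simp: factors_of_def fz[symmetric] f_def p(1))
  qed
  ultimately show ?thesis using that by blast
qed

lemma rauzy_cas_factors:
  assumes "i \<le> j"
  shows "pre_digraph.cas (rauzy_graph X (Suc n)) (factor x (int i) n)
    (map (\<lambda>k. factor x (int k) (Suc n)) [i..<j]) (factor x (int j) n)"
  using assms
proof (induction rule: inc_induct)
  case base
  then show ?case by (simp add: pre_digraph.cas.simps)
next
  case (step i)
  then have "[i..<j] = i # [Suc i..<j]"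
    by (simp add: upt_conv_Cons)
  then show ?case
    using step.IH
    by (simp add: pre_digraph.cas.simps rauzy_graph_def butlast_factor tl_factor add_ac)
qed

text \<open>Once the vertices are words at least as long as a period, a vertex determines the position in \<open>x\<close>
up to the least period, so one turn around \<open>x\<close> repeats no vertex.\<close>

lemma periodic_cycle_rauzy:
  assumes per: "periodic L x" "L \<le> int n"
    and sub: "factors_of x (Suc n) \<subseteq> language (Suc n) X"
  shows "factors_of x (Suc n) \<in> simple_cycles (rauzy_graph X (Suc n))"
proof -
  let ?P = "\<lambda>k. 0 < k \<and> translate (int k) x = x"
  define \<pi> where "\<pi> = (LEAST k. ?P k)"
  have "?P (nat L)"
    using periodic_pos[OF per(1)] translate_period_mult[OF per(1), of 1] by simp
  then have \<pi>: "0 < \<pi>" "translate (int \<pi>) x = x" "\<And>k. 0 < k \<Longrightarrow> k < \<pi> \<Longrightarrow> translate (int k) x \<noteq> x"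
    using LeastI[of ?P] not_less_Least[of _ ?P] unfolding \<pi>_def by blast+
  have per': "periodic (int \<pi>) x"
    using \<pi>(1) fun_cong[OF \<pi>(2)] by (simp add: periodic_def translate_apply)
  let ?G = "rauzy_graph X (Suc n)"
  let ?p = "map (\<lambda>k. factor x (int k) (Suc n)) [0..<\<pi>]"
  have f\<pi>: "factor x (int \<pi>) n = factor x 0 n"
    using \<pi>(2) by (metis add_0 factor_translate)
  then have cas: "pre_digraph.cas ?G (factor x 0 n) ?p (factor x 0 n)"
    using rauzy_cas_factors[of 0 \<pi> X n x] by simp
  have set_p: "set ?p = factors_of x (Suc n)"
  proof
    show "factors_of x (Suc n) \<subseteq> set ?p"
    proof
      fix w assume "w \<in> factors_of x (Suc n)"
      then obtain i where w: "w = factor x i (Suc n)" by (auto simp: factors_of_def)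
      have "w = factor x (i mod int \<pi>) (Suc n)"
      proof -
        have "translate i x = translate (i mod int \<pi>) x"
          using translate_period_mult[OF per', of "i div int \<pi>"]
          by (metis mod_mult_div_eq translate_translate)
        then show ?thesis
          using w by (metis add_0 factor_translate)
      qed
      moreover have "nat (i mod int \<pi>) < \<pi>" "int (nat (i mod int \<pi>)) = i mod int \<pi>"
        using \<pi>(1) by (simp_all add: nat_less_iff)
      ultimately show "w \<in> set ?p"
        by (metis (no_types, lifting) atLeastLessThan_iff image_eqI set_map set_upt zero_le)
    qed
  qed (auto simp: factors_of_def)
  have "factor x 0 n \<in> language n X"
  proof -
    have "factor x 0 (Suc n) \<in> language (Suc n) X"
      using sub by (auto simp: factors_of_def)
    from butlast_in_language[OF this] show ?thesis by (simp add: butlast_factor)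
  qed
  then have walk: "pre_digraph.awalk ?G (factor x 0 n) ?p (factor x 0 n)"
    using cas set_p sub by (simp add: pre_digraph.awalk_def rauzy_graph_def)
  have ne: "?p \<noteq> []" using \<pi>(1) by simp
  have "tl (pre_digraph.awalk_verts ?G (factor x 0 n) ?p) = map (\<lambda>k. factor x (int k + 1) n) [0..<\<pi>]"
    using pre_digraph.awalk_verts_conv'[OF cas] ne by (simp add: rauzy_graph_def tl_factor)
  moreover have "distinct (map (\<lambda>k. factor x (int k + 1) n) [0..<\<pi>])"
  proof -
    have *: "factor x (int i + 1) n \<noteq> factor x (int j + 1) n" if "i < j" "j < \<pi>" for i j
    proof
      assume eq: "factor x (int i + 1) n = factor x (int j + 1) n"
      have "translate (int (j - i)) x = x"
      proof (rule periodic_eqI[OF periodic_translate[OF per(1)] per(1)])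
        fix t assume t: "int i + 1 \<le> t" "t < int i + 1 + L"
        then have "x t = x (t - (int i + 1) + (int j + 1))"
          using factor_eqD[OF eq, of t] per(2) by simp
        then show "translate (int (j - i)) x t = x t"
          using that by (simp add: translate_apply of_nat_diff algebra_simps)
      qed
      with \<pi>(3)[of "j - i"] that show False by simp
    qed
    have "inj_on (\<lambda>k. factor x (int k + 1) n) {0..<\<pi>}"
      by (rule inj_onI) (metis * atLeastLessThan_iff nat_neq_iff)
    then show ?thesis by (simp add: distinct_map)
  qed
  ultimately have "pre_digraph.cycle ?G ?p"
    unfolding pre_digraph.cycle_def using walk ne by auto
  then show ?thesis
    unfolding simple_cycles_def using set_p by blast
qed

lemma cycle_verts_rauzy:
  "cycle_verts (rauzy_graph X (Suc n)) (factors_of x (Suc n)) = factors_of x n"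
proof -
  have "tl ` factors_of x (Suc n) \<subseteq> factors_of x n" "butlast ` factors_of x (Suc n) = factors_of x n"
    by (auto simp: factors_of_def tl_factor butlast_factor image_image)
  then show ?thesis
    by (auto simp: cycle_verts_def rauzy_graph_def)
qed

lemma incoming_arcs_rauzy:
  "incoming_arcs (rauzy_graph X (Suc n)) (factors_of x (Suc n)) =
    {e \<in> language (Suc n) X. tl e \<in> factors_of x n \<and> butlast e \<notin> factors_of x n}"
  unfolding incoming_arcs_def cycle_verts_rauzy by (simp add: rauzy_graph_def)

lemma outgoing_arcs_rauzy:
  "outgoing_arcs (rauzy_graph X (Suc n)) (factors_of x (Suc n)) =
    {e \<in> language (Suc n) X. butlast e \<in> factors_of x n \<and> tl e \<notin> factors_of x n}"
  unfolding outgoing_arcs_def cycle_verts_rauzy by (simp add: rauzy_graph_def)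

text \<open>The generators of the subshifts constructed below. Finitely many sequences with periodic ends admit
common constants \<open>L\<close> and \<open>a\<close>. Members with
\<open>y = lf y\<close> are the periodic ones; they join nothing, so they are exempt from the increase of rank.\<close>

locale graded_family =
  fixes E :: "(int \<Rightarrow> int) set" and lf rt :: "(int \<Rightarrow> int) \<Rightarrow> int \<Rightarrow> int"
    and rank :: "(int \<Rightarrow> int) \<Rightarrow> nat" and L a :: int
  assumes L: "0 < L" and a: "0 \<le> a"
    and per: "\<And>y. y \<in> E \<Longrightarrow> periodic L (lf y)" "\<And>y. y \<in> E \<Longrightarrow> periodic L (rt y)"
    and lf: "\<And>y j. y \<in> E \<Longrightarrow> j < -a \<Longrightarrow> y j = lf y j"
    and rt: "\<And>y j. y \<in> E \<Longrightarrow> a \<le> j \<Longrightarrow> y j = rt y j"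
    and rank_translate: "\<And>t k. rank (translate k t) = rank t"
    and rank_le: "\<And>t. rank t \<le> 2"
    and graded: "\<And>y. y \<in> E \<Longrightarrow> y = lf y \<or> rank (lf y) < rank (rt y)"
begin

definition tails :: "(int \<Rightarrow> int) set" where
  "tails = (\<Union>y\<in>E. orbit (lf y) \<union> orbit (rt y))"

lemma periodic_tails: "t \<in> tails \<Longrightarrow> periodic L t"
  unfolding tails_def using per periodic_orbit by blast

text \<open>A window of length \<open>2 a + 2 L\<close> of \<open>y\<close> contains a full period of the left end or a full period of the
right end. So if the window is a piece of a periodic sequence, that sequence is the end in question,
and \<open>y\<close> agrees with it all the way out to that side.\<close>

lemma rigidity:
  assumes y: "y \<in> E" and t: "periodic L t" and M: "2 * a + 2 * L \<le> M"
    and eq: "\<And>j. s \<le> j \<Longrightarrow> j < s + M \<Longrightarrow> y j = t j"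
  shows "(lf y = t \<and> (\<forall>j<s + M. y j = t j)) \<or> (rt y = t \<and> (\<forall>j\<ge>s. y j = t j))"
proof (cases "s + L \<le> -a")
  case True
  have "lf y = t"
  proof (rule periodic_eqI[OF per(1)[OF y] t])
    fix j assume "s \<le> j" "j < s + L"
    then show "lf y j = t j"
      using lf[OF y, of j] eq[of j] True M a L by simp
  qed
  moreover have "y j = t j" if "j < s + M" for j
    using lf[OF y, of j] eq[of j] that True L calculation by (cases "s \<le> j") simp_all
  ultimately show ?thesis by blast
next
  case False
  have "rt y = t"
  proof (rule periodic_eqI[OF per(2)[OF y] t])
    fix j assume "s + M - L \<le> j" "j < s + M - L + L"
    then show "rt y j = t j"
      using rt[OF y, of j] eq[of j] False M a L by simp
  qed
  moreover have "y j = t j" if "s \<le> j" for j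
    using rt[OF y, of j] eq[of j] that False M L calculation by (cases "j < s + M") simp_all
  ultimately show ?thesis by blast
qed

text \<open>If every window of \<open>z\<close> is a window of the family, then \<open>z\<close> ends in one of the periodic ends. A long
window always contains a shorter window of length \<open>M\<close> taken from an end; pick one whose rank is
maximal. If \<open>z\<close> ever left that end, it would do so along some \<open>y\<close> that leaves its left end, and the
long window would reach far enough to show the right end of \<open>y\<close>, which has larger rank.\<close>

lemma windows_eventually_tail:
  assumes m: "6 * a + 4 * L \<le> int m"
    and z: "\<And>i. \<exists>y\<in>E. \<exists>s. factor z i m = factor y s m"
  obtains t i where "t \<in> tails" "\<forall>j\<ge>i. z j = t j"
proof -
  define M where "M = 2 * a + 2 * L"
  have Mm: "2 * M + 2 * a \<le> int m" using m by (simp add: M_def)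
  have Mpos: "0 < M" using a L by (simp add: M_def)
  define good where "good i t \<longleftrightarrow> t \<in> tails \<and> (\<forall>j. i \<le> j \<and> j < i + M \<longrightarrow> z j = t j)" for i t
  have window: "\<exists>y\<in>E. \<exists>s. \<forall>j. i \<le> j \<and> j < i + int m \<longrightarrow> z j = translate s y j" for i
  proof -
    obtain y s where ys: "y \<in> E" "factor z i m = factor y s m" using z by blast
    have "\<forall>j. i \<le> j \<and> j < i + int m \<longrightarrow> z j = translate (s - i) y j"
      using factor_eqD[OF ys(2)] by (simp add: translate_apply algebra_simps)
    with ys(1) show ?thesis by blast
  qed
  have "\<exists>i t. good i t"
  proof -
    obtain y s where ys: "y \<in> E" "\<And>j. 0 \<le> j \<Longrightarrow> j < int m \<Longrightarrow> z j = translate s y j"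
      using window[of 0] by auto
    show ?thesis
    proof (cases "s + M \<le> -a")
      case True
      have "good 0 (translate s (lf y))"
        unfolding good_def
      proof (intro conjI allI impI)
        show "translate s (lf y) \<in> tails" unfolding tails_def using ys(1) in_orbit by blast
        fix j assume "0 \<le> j \<and> j < 0 + M"
        then show "z j = translate s (lf y) j"
          using ys(2)[of j] lf[OF ys(1), of "j + s"] True Mm a Mpos by (simp add: translate_apply)
      qed
      then show ?thesis by blast
    next
      case False
      have "good (int m - M) (translate s (rt y))"
        unfolding good_def
      proof (intro conjI allI impI)
        show "translate s (rt y) \<in> tails" unfolding tails_def using ys(1) in_orbit by blast
        fix j assume "int m - M \<le> j \<and> j < int m - M + M"
        then show "z j = translate s (rt y) j"
          using ys(2)[of j] rt[OF ys(1), of "j + s"] False Mm a Mpos by (simp add: translate_apply)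
      qed
      then show ?thesis by blast
    qed
  qed
  then obtain p0 where "case_prod good p0" by auto
  moreover have "\<forall>p. case_prod good p \<longrightarrow> rank (snd p) < 3"
    using rank_le by (simp add: le_imp_less_Suc numeral_3_eq_3 numeral_2_eq_2)
  ultimately obtain p where p: "case_prod good p" "\<forall>q. case_prod good q \<longrightarrow> rank (snd q) \<le> rank (snd p)"
    using ex_has_greatest_nat[of "case_prod good" p0 "\<lambda>p. rank (snd p)" 3] by blast
  then obtain i t where good: "good i t" and max: "\<And>i' t'. good i' t' \<Longrightarrow> rank t' \<le> rank t"
    by (cases p) auto
  have t: "t \<in> tails" "periodic L t"
    using good periodic_tails by (auto simp: good_def)
  have step: "good (i' + 1) t" if g: "good i' t" for i'
  proof -
    obtain y s where y: "y \<in> E" and ys: "\<And>j. i' \<le> j \<Longrightarrow> j < i' + int m \<Longrightarrow> z j = translate s y j"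
      using window[of i'] by blast
    have zt: "z j = t j" if "i' \<le> j" "j < i' + M" for j
      using g that by (simp add: good_def)
    let ?t = "translate (-s) t"
    have "y j = ?t j" if "i' + s \<le> j" "j < i' + s + M" for j
      using zt[of "j - s"] ys[of "j - s"] that Mm Mpos a by (simp add: translate_apply)
    then have rigid: "(lf y = ?t \<and> (\<forall>j<i' + s + M. y j = ?t j)) \<or> (rt y = ?t \<and> (\<forall>j\<ge>i' + s. y j = ?t j))"
      by (intro rigidity[OF y periodic_translate[OF t(2)]]) (simp_all add: M_def)
    have "y (i' + s + M) = ?t (i' + s + M)"
    proof (rule ccontr)
      assume ne: "y (i' + s + M) \<noteq> ?t (i' + s + M)"
      then have l: "lf y = ?t" using rigid Mpos by auto
      then have "y \<noteq> lf y" using ne by metis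
      then have less: "rank t < rank (rt y)"
        using graded[OF y] l rank_translate by simp
      \<comment> \<open>The departure from the left end happens inside the middle part of \<open>y\<close> or later.\<close>
      have far: "-a \<le> i' + s + M"
        using ne lf[OF y, of "i' + s + M"] l by force
      have "good (i' + int m - M) (translate s (rt y))"
        unfolding good_def
      proof (intro conjI allI impI)
        show "translate s (rt y) \<in> tails" unfolding tails_def using y in_orbit by blast
        fix j assume j: "i' + int m - M \<le> j \<and> j < i' + int m - M + M"
        then show "z j = translate s (rt y) j"
          using ys[of j] rt[OF y, of "j + s"] far Mm a Mpos by (simp add: translate_apply)
      qed
      then have "rank (rt y) \<le> rank t" using max rank_translate by metis
      with less show False by simp
    qed
    then have "z (i' + M) = t (i' + M)"
      using ys[of "i' + M"] Mm Mpos a by (simp add: translate_apply add_ac)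
    then have "z j = t j" if "i' + 1 \<le> j" "j < i' + 1 + M" for j
      using zt[of j] that by (cases "j = i' + M") simp_all
    then show ?thesis using t by (simp add: good_def)
  qed
  have "good i' t" if "i \<le> i'" for i'
    using that by (induction i' rule: int_ge_induct) (use good step in auto)
  then have "z j = t j" if "i \<le> j" for j
    using that Mpos by (simp add: good_def)
  with t that show ?thesis by blast
qed

lemma periodic_windows_tail:
  assumes "6 * a + 4 * L \<le> int m" "periodic L' z"
    and "\<And>i. \<exists>y\<in>E. \<exists>s. factor z i m = factor y s m"
  shows "z \<in> tails"
proof -
  obtain t i where t: "t \<in> tails" "\<forall>j\<ge>i. z j = t j"
    using windows_eventually_tail[OF assms(1,3)] by blast
  have "z = t"
    by (rule periodic_eq_right[OF assms(2) periodic_tails[OF t(1)], of i]) (use t in blast)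
  with t show ?thesis by simp
qed

text \<open>An arc entering the cycle of \<open>t\<close> comes from a member of the family that has \<open>t\<close> as its right end
without being periodic, so \<open>t\<close> does not have the least rank.\<close>

lemma incoming_rank:
  assumes n: "6 * a + 4 * L \<le> int n" and lang: "language (Suc n) Y = {factor y i (Suc n) | y i. y \<in> E}"
    and t: "t \<in> tails" and ne: "incoming_arcs (rauzy_graph Y (Suc n)) (factors_of t (Suc n)) \<noteq> {}"
  shows "1 \<le> rank t"
proof -
  obtain y s i where y: "y \<in> E" "factor y (s + 1) n = factor t i n" "factor y s n \<notin> factors_of t n"
    using ne unfolding incoming_arcs_rauzy lang
    by (auto simp: tl_factor butlast_factor) (auto simp: factors_of_def)
  let ?t = "translate (i - (s + 1)) t"
  have per_t: "periodic L ?t" using periodic_tails[OF t] by (rule periodic_translate)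
  have not: "\<not> (\<forall>j. s \<le> j \<and> j < s + int n \<longrightarrow> y j = ?t j)"
  proof
    assume "\<forall>j. s \<le> j \<and> j < s + int n \<longrightarrow> y j = ?t j"
    then have "factor y s n = factor ?t s n" by (intro factor_cong) simp
    with y(3) show False by (simp add: factors_of_def)
  qed
  have "y j = ?t j" if "s + 1 \<le> j" "j < s + 1 + int n" for j
    using factor_eqD[OF y(2), of j] that by (simp add: translate_apply algebra_simps)
  then have "(lf y = ?t \<and> (\<forall>j<s + 1 + int n. y j = ?t j)) \<or> (rt y = ?t \<and> (\<forall>j\<ge>s + 1. y j = ?t j))"
    using n a L by (intro rigidity[OF y(1) per_t]) simp_all
  then have r: "rt y = ?t" "\<forall>j\<ge>s + 1. y j = ?t j"
    using not by auto
  have "y \<noteq> lf y"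
  proof
    assume "y = lf y"
    then have "periodic L y" using per(1)[OF y(1)] by simp
    then have "y = ?t" by (rule periodic_eq_right[OF _ per_t, where a = "s + 1"]) (use r(2) in blast)
    then show False using not by metis
  qed
  then have "rank (lf y) < rank (rt y)" using graded[OF y(1)] by simp
  then show ?thesis using r(1) rank_translate by simp
qed

lemma outgoing_rank:
  assumes n: "6 * a + 4 * L \<le> int n" and lang: "language (Suc n) Y = {factor y i (Suc n) | y i. y \<in> E}"
    and t: "t \<in> tails" and ne: "outgoing_arcs (rauzy_graph Y (Suc n)) (factors_of t (Suc n)) \<noteq> {}"
  shows "rank t \<le> 1"
proof -
  obtain y s i where y: "y \<in> E" "factor y s n = factor t i n" "factor y (s + 1) n \<notin> factors_of t n"
    using ne unfolding outgoing_arcs_rauzy lang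
    by (auto simp: tl_factor butlast_factor) (auto simp: factors_of_def)
  let ?t = "translate (i - s) t"
  have per_t: "periodic L ?t" using periodic_tails[OF t] by (rule periodic_translate)
  have not: "\<not> (\<forall>j. s + 1 \<le> j \<and> j < s + 1 + int n \<longrightarrow> y j = ?t j)"
  proof
    assume "\<forall>j. s + 1 \<le> j \<and> j < s + 1 + int n \<longrightarrow> y j = ?t j"
    then have "factor y (s + 1) n = factor ?t (s + 1) n" by (intro factor_cong) simp
    with y(3) show False by (simp add: factors_of_def)
  qed
  have "y j = ?t j" if "s \<le> j" "j < s + int n" for j
    using factor_eqD[OF y(2), of j] that by (simp add: translate_apply algebra_simps)
  then have "(lf y = ?t \<and> (\<forall>j<s + int n. y j = ?t j)) \<or> (rt y = ?t \<and> (\<forall>j\<ge>s. y j = ?t j))"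
    using n a L by (intro rigidity[OF y(1) per_t]) simp_all
  then have l: "lf y = ?t"
    using not by auto
  have "y \<noteq> lf y" using l not by metis
  then have "rank (lf y) < rank (rt y)" using graded[OF y(1)] by simp
  then show ?thesis using l rank_translate rank_le[of "rt y"] by simp
qed

text \<open>A simple cycle is traced by a periodic sequence, which must be one of the ends. Incoming and outgoing
arcs force its rank to be 1, so it is \<open>\<kappa>\<close>. Conversely \<open>u\<close> enters and \<open>v\<close> leaves the cycle of \<open>\<kappa>\<close>:
the witnesses are the window of \<open>u\<close> starting at the last disagreement with \<open>\<kappa>\<close> and the window of \<open>v\<close>
ending at the first one.\<close>

lemma one_middle_cycle_if_graded:
  assumes n: "6 * a + 4 * L \<le> int n"
    and lang: "language (Suc n) Y = {factor y i (Suc n) | y i. y \<in> E}"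
    and u: "u \<in> E" "rt u = \<kappa>" "rank (lf u) = 0" and v: "v \<in> E" "lf v = \<kappa>" "rank (rt v) = 2"
    and rank1: "\<And>t. rank t = 1 \<longleftrightarrow> t \<in> orbit \<kappa>"
  shows "one_middle_cycle (rauzy_graph Y (Suc n))"
proof -
  let ?G = "rauzy_graph Y (Suc n)"
  let ?K = "factors_of \<kappa> (Suc n)"
  have \<kappa>: "periodic L \<kappa>" "rank \<kappa> = 1" using per(2)[OF u(1)] u(2) rank1[of \<kappa>] by auto
  have "factor \<kappa> i (Suc n) \<in> language (Suc n) Y" for i
  proof -
    have "right_tail u \<kappa>" using rt[OF u(1)] u(2) by (auto simp: right_tail_def)
    from factor_right_tail[OF this \<kappa>(1)] obtain j where "factor \<kappa> i (Suc n) = factor u j (Suc n)"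
      by blast
    then show ?thesis using u(1) lang by auto
  qed
  then have K: "?K \<in> simple_cycles ?G"
    using n a L by (intro periodic_cycle_rauzy[OF \<kappa>(1)]) (auto simp: factors_of_def)
  have "\<exists>s. u s \<noteq> \<kappa> s \<and> (\<forall>j>s. u j = \<kappa> j)"
  proof (rule ccontr)
    assume *: "\<nexists>s. u s \<noteq> \<kappa> s \<and> (\<forall>j>s. u j = \<kappa> j)"
    have **: "\<forall>j\<ge>a - int k. u j = \<kappa> j" for k
    proof (induction k)
      case 0
      then show ?case using rt[OF u(1)] u(2) by simp
    next
      case (Suc k)
      then have "\<forall>j>a - int k - 1. u j = \<kappa> j" by simp
      then have eq: "u (a - int k - 1) = \<kappa> (a - int k - 1)" using * by blast
      show ?case
      proof (intro allI impI)
        fix j assume "a - int (Suc k) \<le> j"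
        then have "j = a - int k - 1 \<or> a - int k \<le> j" by (simp only: of_nat_Suc) linarith
        then show "u j = \<kappa> j" using Suc eq by blast
      qed
    qed
    have "u j = \<kappa> j" if "j < -a" for j
      using **[of "nat (a - j)"] that a by auto
    then have "lf u = \<kappa>"
      using lf[OF u(1)] by (intro periodic_eq_left[OF per(1)[OF u(1)] \<kappa>(1), of "-a"]) simp
    with u(3) \<kappa>(2) show False by simp
  qed
  then obtain s where s: "u s \<noteq> \<kappa> s" "\<forall>j>s. u j = \<kappa> j" by blast
  have "factor u s n \<notin> factors_of \<kappa> n"
  proof
    assume "factor u s n \<in> factors_of \<kappa> n"
    then obtain i where i: "factor u s n = factor \<kappa> i n" by (auto simp: factors_of_def)
    let ?t = "translate (i - s) \<kappa>"
    have "u j = ?t j" if "s \<le> j" "j < s + int n" for j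
      using factor_eqD[OF i, of j] that by (simp add: translate_apply algebra_simps)
    then have "(lf u = ?t \<and> (\<forall>j<s + int n. u j = ?t j)) \<or> (rt u = ?t \<and> (\<forall>j\<ge>s. u j = ?t j))"
      using n a L periodic_translate[OF \<kappa>(1)] by (intro rigidity[OF u(1)]) simp_all
    then show False
    proof
      assume "lf u = ?t \<and> (\<forall>j<s + int n. u j = ?t j)"
      then show False using u(3) \<kappa>(2) rank_translate by (metis zero_neq_one)
    next
      assume "rt u = ?t \<and> (\<forall>j\<ge>s. u j = ?t j)"
      then have "u s = \<kappa> s" using u(2) by auto
      with s(1) show False ..
    qed
  qed
  moreover have "factor u (s + 1) n = factor \<kappa> (s + 1) n"
    using s(2) by (intro factor_cong) simp
  ultimately have inc: "incoming_arcs ?G ?K \<noteq> {}"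
  proof -
    assume "factor u s n \<notin> factors_of \<kappa> n" "factor u (s + 1) n = factor \<kappa> (s + 1) n"
    then have "factor u s (Suc n) \<in> incoming_arcs ?G ?K"
      unfolding incoming_arcs_rauzy lang using u(1)
      by (auto simp: tl_factor butlast_factor) (simp add: factors_of_def)
    then show ?thesis by blast
  qed
  have "\<exists>s. v s \<noteq> \<kappa> s \<and> (\<forall>j<s. v j = \<kappa> j)"
  proof (rule ccontr)
    assume *: "\<nexists>s. v s \<noteq> \<kappa> s \<and> (\<forall>j<s. v j = \<kappa> j)"
    have **: "\<forall>j<int k - a. v j = \<kappa> j" for k
    proof (induction k)
      case 0
      then show ?case using lf[OF v(1)] v(2) by simp
    next
      case (Suc k)
      then have eq: "v (int k - a) = \<kappa> (int k - a)" using * by blast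
      show ?case
      proof (intro allI impI)
        fix j assume "j < int (Suc k) - a"
        then have "j = int k - a \<or> j < int k - a" by (simp only: of_nat_Suc) linarith
        then show "v j = \<kappa> j" using Suc eq by blast
      qed
    qed
    have "v j = \<kappa> j" for j
      using **[of "nat (j + a + 1)"] a by (cases "0 \<le> j + a + 1") (auto simp: lf[OF v(1)] v(2))
    then have "rt v = \<kappa>"
      using rt[OF v(1)] by (intro periodic_eq_right[OF per(2)[OF v(1)] \<kappa>(1), of a]) simp
    with v(3) \<kappa>(2) show False by simp
  qed
  then obtain s' where s': "v s' \<noteq> \<kappa> s'" "\<forall>j<s'. v j = \<kappa> j" by blast
  \<comment> \<open>The window of \<open>n + 1\<close> letters at \<open>s' - n\<close> ends exactly at the first disagreement.\<close>
  let ?s = "s' - int n"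
  have "factor v (?s + 1) n \<notin> factors_of \<kappa> n"
  proof
    assume "factor v (?s + 1) n \<in> factors_of \<kappa> n"
    then obtain i where i: "factor v (?s + 1) n = factor \<kappa> i n" by (auto simp: factors_of_def)
    let ?t = "translate (i - (?s + 1)) \<kappa>"
    have "v j = ?t j" if "?s + 1 \<le> j" "j < ?s + 1 + int n" for j
      using factor_eqD[OF i, of j] that by (simp add: translate_apply algebra_simps)
    then have "(lf v = ?t \<and> (\<forall>j<?s + 1 + int n. v j = ?t j)) \<or> (rt v = ?t \<and> (\<forall>j\<ge>?s + 1. v j = ?t j))"
      using n a L periodic_translate[OF \<kappa>(1)] by (intro rigidity[OF v(1)]) simp_all
    then show False
    proof
      assume "lf v = ?t \<and> (\<forall>j<?s + 1 + int n. v j = ?t j)"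
      then have "v s' = \<kappa> s'" using v(2) by auto
      with s'(1) show False ..
    next
      assume "rt v = ?t \<and> (\<forall>j\<ge>?s + 1. v j = ?t j)"
      then have "rank (rt v) = rank \<kappa>" using rank_translate by metis
      with v(3) \<kappa>(2) show False by simp
    qed
  qed
  moreover have "factor v ?s n = factor \<kappa> ?s n"
    using s'(2) by (intro factor_cong) simp
  ultimately have out: "outgoing_arcs ?G ?K \<noteq> {}"
  proof -
    assume "factor v (?s + 1) n \<notin> factors_of \<kappa> n" "factor v ?s n = factor \<kappa> ?s n"
    then have "factor v ?s (Suc n) \<in> outgoing_arcs ?G ?K"
      unfolding outgoing_arcs_rauzy lang using v(1)
      by (auto simp: tl_factor butlast_factor) (simp add: factors_of_def)
    then show ?thesis by blast
  qed
  show ?thesis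
    unfolding one_middle_cycle_def
  proof (rule ex1I[of _ ?K])
    show "?K \<in> simple_cycles ?G \<and> incoming_arcs ?G ?K \<noteq> {} \<and> outgoing_arcs ?G ?K \<noteq> {}"
      using K inc out by blast
    fix C assume C: "C \<in> simple_cycles ?G \<and> incoming_arcs ?G C \<noteq> {} \<and> outgoing_arcs ?G C \<noteq> {}"
    then have "C \<in> simple_cycles ?G" ..
    then obtain z L' where z: "periodic L' z" "C = factors_of z (Suc n)"
      by (rule rauzy_cycle_periodic)
    have sub: "C \<subseteq> language (Suc n) Y"
      using C by (auto simp: simple_cycles_def pre_digraph.cycle_def pre_digraph.awalk_def rauzy_graph_def)
    have "z \<in> tails"
    proof (rule periodic_windows_tail[OF _ z(1), of "Suc n"])
      show "6 * a + 4 * L \<le> int (Suc n)" using n by simp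
      show "\<exists>y\<in>E. \<exists>s. factor z i (Suc n) = factor y s (Suc n)" for i
      proof -
        have "factor z i (Suc n) \<in> language (Suc n) Y"
          using sub z(2) by (auto simp: factors_of_def)
        then show ?thesis using lang by blast
      qed
    qed
    then have "rank z = 1"
      using incoming_rank[OF n lang] outgoing_rank[OF n lang] C z(2) by (metis le_antisym)
    then have "z \<in> orbit \<kappa>" using rank1 by blast
    then show "C = ?K" using z(2) factors_of_orbit by simp
  qed
qed

end

section \<open>Subshifts near a given one\<close>

text \<open>The smallest subshift containing \<open>E\<close>, described by its words, so that its language is that of \<open>E\<close> by
definition and its limit points never have to be listed.\<close>

definition factor_closure :: "(int \<Rightarrow> int) set \<Rightarrow> (int \<Rightarrow> int) set" where
  "factor_closure E = {x. \<forall>i n. \<exists>y\<in>E. \<exists>j. factor x i n = factor y j n}"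

lemma factor_in_language: "x \<in> X \<Longrightarrow> factor x i n \<in> language n X"
  by (auto simp: language_eq_factors)

lemma subset_factor_closure: "E \<subseteq> factor_closure E"
  by (auto simp: factor_closure_def)

lemma language_factor_closure:
  "language n (factor_closure E) = {factor y i n | y i. y \<in> E}"
proof
  show "language n (factor_closure E) \<subseteq> {factor y i n | y i. y \<in> E}"
    unfolding language_eq_factors factor_closure_def by blast
  show "{factor y i n | y i. y \<in> E} \<subseteq> language n (factor_closure E)"
    using subset_factor_closure[of E] by (auto simp: language_eq_factors)
qed

lemma shift_eq_translate: "shift x = translate 1 x"
  by (simp add: shift_def translate_def)

lemma translate_subshift: "subshift X \<Longrightarrow> x \<in> X \<Longrightarrow> translate k x \<in> X"
  using shift_int_mem by (auto simp: subshift_def translate_def)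

lemma subshift_factor_closure:
  assumes "E \<noteq> {}" "finite B" and B: "\<And>y i. y \<in> E \<Longrightarrow> y i \<in> B"
  shows "subshift (factor_closure E)"
proof -
  let ?W = "\<lambda>n. {factor y j n | y j. y \<in> E}"
  have finW: "finite (?W n)" for n
  proof (rule finite_subset)
    show "?W n \<subseteq> {w. set w \<subseteq> B \<and> length w = n}"
      using B by (auto simp: factor_def)
    show "finite {w. set w \<subseteq> B \<and> length w = n}"
      using assms(2) by (rule finite_lists_length_eq)
  qed
  have "closed {x :: int \<Rightarrow> int. x j = c}" for j c
    by (rule closed_Collect_eq[OF continuous_on_product_coordinates continuous_on_const])
  moreover have "{x. factor x i n = w} =
      (if length w = n then \<Inter>k\<in>{..<n}. {x. x (i + int k) = w ! k} else {})" for i n w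
    by (auto simp: factor_def list_eq_iff_nth_eq)
  ultimately have cl: "closed {x. factor x i n = w}" for i n w
    by (auto intro: closed_INT)
  have eq: "factor_closure E = (\<Inter>i. \<Inter>n. \<Union>w\<in>?W n. {x. factor x i n = w})"
    unfolding factor_closure_def by blast
  have "closed (factor_closure E)"
    unfolding eq by (intro closed_INT ballI closed_UN[OF finW] cl)
  moreover have "compact (PiE UNIV (\<lambda>_. B) :: (int \<Rightarrow> int) set)"
  proof -
    have "compactin (product_topology (\<lambda>_. euclidean) UNIV) (PiE UNIV (\<lambda>_. B) :: (int \<Rightarrow> int) set)"
      using finite_imp_compact[OF assms(2)] unfolding compactin_PiE compactin_euclidean_iff by blast
    then show ?thesis by (simp only: euclidean_product_topology compactin_euclidean_iff)
  qed
  moreover have "factor_closure E \<subseteq> PiE UNIV (\<lambda>_. B)"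
  proof
    fix x assume x: "x \<in> factor_closure E"
    have "x i \<in> B" for i
    proof -
      have "\<exists>y\<in>E. \<exists>j. factor x i 1 = factor y j 1"
        using x unfolding factor_closure_def by blast
      then obtain y j where "y \<in> E" "factor x i 1 = factor y j 1" by blast
      then show ?thesis using B by (simp add: factor_def)
    qed
    then show "x \<in> PiE UNIV (\<lambda>_. B)" by auto
  qed
  ultimately have "compact (factor_closure E)"
    by (metis closed_Int_compact inf.absorb1)
  moreover have "factor_closure E \<noteq> {}"
    using subset_factor_closure assms(1) by blast
  moreover have tr: "translate k x \<in> factor_closure E" if "x \<in> factor_closure E" for k x
    using that by (simp add: factor_closure_def)
  have "shift ` factor_closure E = factor_closure E"
  proof
    show "shift ` factor_closure E \<subseteq> factor_closure E"
      using tr by (auto simp: shift_eq_translate)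
    show "factor_closure E \<subseteq> shift ` factor_closure E"
    proof
      fix x assume "x \<in> factor_closure E"
      then have "translate (-1) x \<in> factor_closure E" by (rule tr)
      moreover have "x = shift (translate (-1) x)" by (simp add: shift_eq_translate)
      ultimately show "x \<in> shift ` factor_closure E" by blast
    qed
  qed
  ultimately show ?thesis by (simp add: subshift_def)
qed

lemma finite_language:
  assumes X: "subshift X"
  shows "finite (language n X)"
proof -
  have "compact ((\<lambda>x. x 0) ` X)"
    using X unfolding subshift_def
    by (intro compact_continuous_image continuous_on_subset[OF continuous_on_product_coordinates]) simp_all
  then have fin: "finite ((\<lambda>x. x (0::int)) ` X)"
  proof (rule compactE_image[where C = "(\<lambda>x. x 0) ` X" and f = "\<lambda>k. {k}"])
    fix C' assume C': "C' \<subseteq> (\<lambda>x. x 0) ` X" "finite C'" "(\<lambda>x. x 0) ` X \<subseteq> (\<Union>c\<in>C'. {c})"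
    then have "(\<lambda>x. x 0) ` X \<subseteq> C'" by auto
    then show ?thesis using C'(2) finite_subset by blast
  qed (auto simp: open_discrete)
  have letters: "x i \<in> (\<lambda>x. x 0) ` X" if "x \<in> X" for x i
  proof -
    have "x i = translate i x 0" by (simp add: translate_apply)
    then show ?thesis using translate_subshift[OF X that] by blast
  qed
  have "language n X \<subseteq> {w. set w \<subseteq> (\<lambda>x. x 0) ` X \<and> length w = n}"
    using letters by (auto simp: language_eq_factors factor_def)
  then show ?thesis
    by (rule finite_subset) (rule finite_lists_length_eq[OF fin])
qed

lemma language_eq_if_le:
  assumes "language n X = language n Y" "k \<le> n"
  shows "language k X = language k Y"
proof -
  have "factor x i k = take k (factor x i n)" for x i
    using assms(2) by (simp add: factor_def take_map)
  then have "language k Z = take k ` language n Z" for Z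
    unfolding language_eq_factors by auto
  with assms(1) show ?thesis by simp
qed

lemma subshift_dist_less_iff:
  assumes "subshift X" "subshift Y"
  shows "subshift_dist X Y < 2 powr - real n \<longleftrightarrow> language n X = language n Y"
proof (cases "X = Y")
  case False
  let ?D = "{n. language n X \<noteq> language n Y}"
  have "?D \<noteq> {}" using False subshift_eqI[OF assms] by blast
  then have mem: "Inf ?D \<in> ?D" by (rule Inf_nat_def1)
  have "n < Inf ?D \<longleftrightarrow> language n X = language n Y"
  proof
    assume "n < Inf ?D"
    then show "language n X = language n Y"
      by (metis (mono_tags, lifting) linorder_not_le mem_Collect_eq wellorder_Inf_le1)
  next
    assume "language n X = language n Y"
    then show "n < Inf ?D"
      using mem language_eq_if_le by (metis (mono_tags, lifting) linorder_not_le mem_Collect_eq)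
  qed
  then show ?thesis using False by (simp add: subshift_dist_def)
qed (simp add: subshift_dist_def)

text \<open>Subshifts with the same words of length \<open>n\<close> form the balls of the metric.\<close>

lemma openin_subshifts_iff:
  "openin subshift_space.mtopology \<U> \<longleftrightarrow> \<U> \<subseteq> Collect subshift \<and>
     (\<forall>X\<in>\<U>. \<exists>n. \<forall>Y. subshift Y \<longrightarrow> language n Y = language n X \<longrightarrow> Y \<in> \<U>)"
proof -
  have "(\<exists>r>0. subshift_space.mball X r \<subseteq> \<U>) \<longleftrightarrow>
      (\<exists>n. \<forall>Y. subshift Y \<longrightarrow> language n Y = language n X \<longrightarrow> Y \<in> \<U>)" if X: "subshift X" for X
  proof
    assume "\<exists>r>0. subshift_space.mball X r \<subseteq> \<U>"
    then obtain r where r: "0 < r" "subshift_space.mball X r \<subseteq> \<U>" by blast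
    obtain n where "(1 / 2 :: real) ^ n < r"
      using real_arch_pow_inv[OF r(1), of "1/2"] by auto
    then have n: "2 powr - real n < r"
      by (simp add: powr_minus powr_realpow power_divide field_simps)
    have "Y \<in> \<U>" if "subshift Y" "language n Y = language n X" for Y
      using subshift_dist_less_iff[OF X that(1), of n] that X n r(2) by auto
    then show "\<exists>n. \<forall>Y. subshift Y \<longrightarrow> language n Y = language n X \<longrightarrow> Y \<in> \<U>" by blast
  next
    assume "\<exists>n. \<forall>Y. subshift Y \<longrightarrow> language n Y = language n X \<longrightarrow> Y \<in> \<U>"
    then obtain n where n: "\<And>Y. subshift Y \<Longrightarrow> language n Y = language n X \<Longrightarrow> Y \<in> \<U>" by blast
    then have "subshift_space.mball X (2 powr - real n) \<subseteq> \<U>"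
      using subshift_dist_less_iff[of X] by auto
    then show "\<exists>r>0. subshift_space.mball X r \<subseteq> \<U>"
      by (intro exI[of _ "2 powr - real n"]) simp
  qed
  then show ?thesis
    unfolding subshift_space.openin_mtopology by blast
qed

lemma sft_language: "subshift X \<Longrightarrow> sft (language (Suc N) X)"
  by (simp add: sft_def finite_language)

text \<open>Without a middle point at level \<open>N\<close> there are finitely many orbits of paths, hence finitely many
subshifts with the same words of length \<open>N + 1\<close> as \<open>X\<close>. A finite open set in a metric space consists
of isolated points.\<close>

lemma middle_if_not_isolated:
  assumes X: "X \<in> non_isolated_subshifts"
  shows "\<exists>\<kappa>. sft.middle N (language (Suc N) X) \<kappa>"
proof (rule ccontr)
  assume no: "\<nexists>\<kappa>. sft.middle N (language (Suc N) X) \<kappa>"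
  have sX: "subshift X" and niso: "\<not> openin subshift_space.mtopology {X}"
    using X by (auto simp: non_isolated_subshifts_def)
  interpret sft N "language (Suc N) X" by (rule sft_language[OF sX])
  obtain F where F: "finite F" "\<forall>x\<in>points. \<exists>k. translate k x \<in> F"
    using finite_orbits_if_no_middle no by blast
  let ?B = "{Y. subshift Y \<and> language (Suc N) Y = language (Suc N) X}"
  have sub: "Y \<subseteq> points" if "Y \<in> ?B" for Y
  proof -
    have "language (Suc N) Y = language (Suc N) X" using that by simp
    then show ?thesis using factor_in_language[of _ Y] by (auto simp: points_def)
  qed
  have le: "Y \<subseteq> Z" if "Y \<in> ?B" "Z \<in> ?B" "Y \<inter> F = Z \<inter> F" for Y Z
  proof
    have Y: "Y \<subseteq> points" using that(1) by (rule sub)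
    fix y assume y: "y \<in> Y"
    then obtain k where k: "translate k y \<in> F" using Y F(2) by auto
    have "translate k y \<in> Y \<inter> F"
      using k that(1) translate_subshift[of Y y k] y by simp
    then have "translate k y \<in> Z" unfolding that(3) by simp
    then have "translate (-k) (translate k y) \<in> Z"
      using that(2) translate_subshift[of Z "translate k y" "-k"] by blast
    then show "y \<in> Z" by simp
  qed
  have "inj_on (\<lambda>Y. Y \<inter> F) ?B"
  proof (rule inj_onI)
    fix Y Z assume "Y \<in> ?B" "Z \<in> ?B" "Y \<inter> F = Z \<inter> F"
    then show "Y = Z"
      using le[of Y Z] le[of Z Y] by (intro subset_antisym) blast+
  qed
  moreover have "finite ((\<lambda>Y. Y \<inter> F) ` ?B)"
    by (rule finite_subset[of _ "Pow F"]) (use F(1) in simp_all, blast)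
  ultimately have fin: "finite ?B" by (rule finite_imageD[rotated])
  have "openin subshift_space.mtopology ?B"
    unfolding openin_subshifts_iff by (intro conjI ballI exI[of _ "Suc N"]) auto
  moreover have "closedin subshift_space.mtopology (?B - {X})"
    by (rule closedin_Hausdorff_finite[OF subshift_space.Hausdorff_space_mtopology]) (use fin in auto)
  ultimately have "openin subshift_space.mtopology (?B - (?B - {X}))"
    by (rule openin_diff)
  moreover have "?B - (?B - {X}) = {X}" using sX by auto
  ultimately show False using niso by simp
qed

lemma graded_constants:
  assumes "finite E" and conn: "\<And>y. y \<in> E \<Longrightarrow> connects y (lf y) (rt y)"
  obtains L a where "0 < L" "0 \<le> a" "\<And>y. y \<in> E \<Longrightarrow> periodic L (lf y)" "\<And>y. y \<in> E \<Longrightarrow> periodic L (rt y)"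
    "\<And>y j. y \<in> E \<Longrightarrow> j < -a \<Longrightarrow> y j = lf y j" "\<And>y j. y \<in> E \<Longrightarrow> a \<le> j \<Longrightarrow> y j = rt y j"
proof -
  have fin: "finite (lf ` E \<union> rt ` E)" using assms(1) by simp
  have "\<exists>L. periodic L x" if "x \<in> lf ` E \<union> rt ` E" for x
    using that conn unfolding connects_def by blast
  then obtain L where L: "0 < L" "\<forall>x\<in>lf ` E \<union> rt ` E. periodic L x"
    using common_period[OF fin] by blast
  have "\<forall>y\<in>E. \<exists>b::int. 0 \<le> b \<and> (\<forall>j. j < -b \<longrightarrow> y j = lf y j) \<and> (\<forall>j\<ge>b. y j = rt y j)"
  proof
    fix y assume "y \<in> E"
    then obtain b c where "\<forall>j<b. y j = lf y j" "\<forall>j\<ge>c. y j = rt y j"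
      using conn[of y] unfolding connects_def left_tail_def right_tail_def by blast
    then show "\<exists>b::int. 0 \<le> b \<and> (\<forall>j. j < -b \<longrightarrow> y j = lf y j) \<and> (\<forall>j\<ge>b. y j = rt y j)"
      by (intro exI[of _ "\<bar>b\<bar> + \<bar>c\<bar>"]) auto
  qed
  from bchoice[OF this] obtain b where b: "\<And>y. y \<in> E \<Longrightarrow> (0::int) \<le> b y"
    "\<And>y j. y \<in> E \<Longrightarrow> j < - b y \<Longrightarrow> y j = lf y j" "\<And>y j. y \<in> E \<Longrightarrow> b y \<le> j \<Longrightarrow> y j = rt y j"
    by auto
  define a where "a = (\<Sum>y\<in>E. b y)"
  have le: "b y \<le> a" if "y \<in> E" for y
    unfolding a_def using that b(1) assms(1) by (intro member_le_sum) auto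
  show ?thesis
  proof (rule that[of L a])
    show "0 \<le> a" unfolding a_def using b(1) by (rule sum_nonneg)
    show "y j = lf y j" if "y \<in> E" "j < -a" for y j
      using b(2)[OF that(1)] le[OF that(1)] that(2) by simp
    show "y j = rt y j" if "y \<in> E" "a \<le> j" for y j
      using b(3)[OF that(1)] le[OF that(1)] that(2) by simp
  qed (use L in auto)
qed

lemma factor_closure_subshift_points:
  assumes X: "subshift X" and E: "E \<subseteq> sft.points N (language (Suc N) X)"
    and cover: "\<forall>w\<in>language (Suc N) X. \<exists>y\<in>E. \<exists>i. factor y i (Suc N) = w"
  shows "subshift (factor_closure E)"
    "language (Suc N) (factor_closure E) = language (Suc N) X"
proof -
  note sft = sft_language[OF X, of N]
  obtain x where "x \<in> X" using X by (auto simp: subshift_def)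
  then have "factor x 0 (Suc N) \<in> language (Suc N) X" by (auto simp: language_eq_factors)
  then have "E \<noteq> {}" using cover by blast
  then show "subshift (factor_closure E)"
    using E sft.points_letters[OF sft] finite_language[OF X]
    by (intro subshift_factor_closure[where B = "\<Union> (set ` language (Suc N) X)"]) auto
  show "language (Suc N) (factor_closure E) = language (Suc N) X"
    unfolding language_factor_closure
  proof
    show "{factor y i (Suc N) | y i. y \<in> E} \<subseteq> language (Suc N) X"
      using E sft.pointsD[OF sft] by blast
    show "language (Suc N) X \<subseteq> {factor y i (Suc N) | y i. y \<in> E}"
    proof
      fix w assume "w \<in> language (Suc N) X"
      then obtain y i where "y \<in> E" "factor y i (Suc N) = w" using cover by blast
      then show "w \<in> {factor y i (Suc N) | y i. y \<in> E}" by blast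
    qed
  qed
qed

text \<open>At each level, the source-to-sink paths through all arcs generate a subshift with the same words as \<open>X\<close>.
It omits \<open>\<kappa>\<close>, because its only periodic points are sources and sinks, and so it differs from \<open>X\<close>.\<close>

lemma not_isolated_if_middle:
  assumes X: "subshift X" and \<kappa>: "\<kappa> \<in> X" and mid: "\<And>N. sft.middle N (language (Suc N) X) \<kappa>"
  shows "X \<in> non_isolated_subshifts"
proof -
  have False if op: "openin subshift_space.mtopology {X}"
  proof -
    obtain N where N: "\<And>Y. subshift Y \<Longrightarrow> language N Y = language N X \<Longrightarrow> Y = X"
      using op unfolding openin_subshifts_iff by auto
    interpret sft N "language (Suc N) X" by (rule sft_language[OF X])
    have "X \<subseteq> points" by (auto simp: points_def intro: factor_in_language)
    then have ext: "\<And>w. w \<in> language (Suc N) X \<Longrightarrow> \<exists>x\<in>points. \<exists>i. factor x i (Suc N) = w"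
      unfolding language_eq_factors by blast
    obtain rank :: "(int \<Rightarrow> int) \<Rightarrow> nat" and E u v where
      rank: "\<forall>t k. rank (translate k t) = rank t" "\<forall>t. rank t \<le> 2" "\<forall>t. rank t = 1 \<longleftrightarrow> t \<in> orbit \<kappa>"
      and E: "finite E" "E \<subseteq> points" "\<forall>w\<in>language (Suc N) X. \<exists>y\<in>E. \<exists>i. factor y i (Suc N) = w"
      and conn: "\<forall>y\<in>E. \<exists>l r. connects y l r \<and> rank l \<noteq> 1 \<and> rank r \<noteq> 1 \<and> (y = l \<or> rank l < rank r)"
      and "u \<in> points" "\<exists>l. connects u l \<kappa> \<and> rank l = 0"
      and "v \<in> points" "\<exists>r. connects v \<kappa> r \<and> rank r = 2"
      by (rule connecting_points[OF mid[of N] ext])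
    from bchoice[OF conn] obtain lf where "\<forall>y\<in>E. \<exists>r. connects y (lf y) r \<and> rank (lf y) \<noteq> 1 \<and>
        rank r \<noteq> 1 \<and> (y = lf y \<or> rank (lf y) < rank r)" by blast
    from bchoice[OF this] obtain rt where ends: "\<And>y. y \<in> E \<Longrightarrow> connects y (lf y) (rt y) \<and>
        rank (lf y) \<noteq> 1 \<and> rank (rt y) \<noteq> 1 \<and> (y = lf y \<or> rank (lf y) < rank (rt y))"
      by blast
    obtain L a where La: "0 < L" "0 \<le> a" "\<And>y. y \<in> E \<Longrightarrow> periodic L (lf y)" "\<And>y. y \<in> E \<Longrightarrow> periodic L (rt y)"
      "\<And>y j. y \<in> E \<Longrightarrow> j < -a \<Longrightarrow> y j = lf y j" "\<And>y j. y \<in> E \<Longrightarrow> a \<le> j \<Longrightarrow> y j = rt y j"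
      using graded_constants[OF E(1), of lf rt] ends by blast
    interpret graded_family E lf rt rank L a
      by unfold_locales (use La rank ends in blast)+
    have "factor_closure E = X"
    proof (rule N)
      show "language N (factor_closure E) = language N X"
        using factor_closure_subshift_points(2)[OF X E(2,3)] by (rule language_eq_if_le) simp
    qed (rule factor_closure_subshift_points(1)[OF X E(2,3)])
    then have "\<kappa> \<in> factor_closure E" using \<kappa> by simp
    then have win: "\<And>i n. \<exists>y\<in>E. \<exists>s. factor \<kappa> i n = factor y s n"
      by (simp add: factor_closure_def)
    obtain L' where "periodic L' \<kappa>" using mid[of N] unfolding middle_def by blast
    then have "\<kappa> \<in> tails"
      by (rule periodic_windows_tail[of "nat (6 * a + 4 * L)", rotated]) (use win in auto)
    then obtain y where "y \<in> E" "\<kappa> \<in> orbit (lf y) \<or> \<kappa> \<in> orbit (rt y)"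
      by (auto simp: tails_def)
    then have "rank \<kappa> \<noteq> 1" using ends rank(1) by (metis orbitE)
    moreover have "rank \<kappa> = 1" using rank(3) by simp
    ultimately show False by simp
  qed
  then show ?thesis using X by (auto simp: non_isolated_subshifts_def)
qed

text \<open>The approximating subshift is generated by the source-to-sink paths together with \<open>u\<close> and \<open>v\<close>. The
sequence \<open>\<kappa>\<close> and both witnesses lie in it, so \<open>\<kappa>\<close> is a middle point at every level and the subshift is
not isolated, while at a high level \<open>\<kappa>\<close> traces the only middle cycle.\<close>

lemma OMC_near_non_isolated:
  assumes X: "X \<in> non_isolated_subshifts"
  obtains Y where "Y \<in> OMC" "Y \<in> non_isolated_subshifts" "language (Suc N) Y = language (Suc N) X"
proof -
  have sX: "subshift X" using X by (auto simp: non_isolated_subshifts_def)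
  interpret sft N "language (Suc N) X" by (rule sft_language[OF sX])
  obtain \<kappa> where \<kappa>: "middle \<kappa>" using middle_if_not_isolated[OF X] by blast
  have "X \<subseteq> points" by (auto simp: points_def intro: factor_in_language)
  then have ext: "\<And>w. w \<in> language (Suc N) X \<Longrightarrow> \<exists>x\<in>points. \<exists>i. factor x i (Suc N) = w"
    unfolding language_eq_factors by blast
  obtain rank :: "(int \<Rightarrow> int) \<Rightarrow> nat" and E0 u v where
    rank: "\<forall>t k. rank (translate k t) = rank t" "\<forall>t. rank t \<le> 2" "\<forall>t. rank t = 1 \<longleftrightarrow> t \<in> orbit \<kappa>"
    and E0: "finite E0" "E0 \<subseteq> points" "\<forall>w\<in>language (Suc N) X. \<exists>y\<in>E0. \<exists>i. factor y i (Suc N) = w"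
    and conn: "\<forall>y\<in>E0. \<exists>l r. connects y l r \<and> rank l \<noteq> 1 \<and> rank r \<noteq> 1 \<and> (y = l \<or> rank l < rank r)"
    and u: "u \<in> points" "\<exists>l. connects u l \<kappa> \<and> rank l = 0"
    and v: "v \<in> points" "\<exists>r. connects v \<kappa> r \<and> rank r = 2"
    by (rule connecting_points[OF \<kappa> ext])
  obtain l where l: "connects u l \<kappa>" "rank l = 0" using u(2) by blast
  obtain r where r: "connects v \<kappa> r" "rank r = 2" using v(2) by blast
  define E where "E = insert u (insert v E0)"
  have rank_\<kappa>: "rank \<kappa> = 1" using rank(3) by simp
  have per_\<kappa>: "\<exists>L. periodic L \<kappa>" using \<kappa> by (simp add: middle_def)
  have conn': "\<forall>y\<in>E. \<exists>l r. connects y l r \<and> (y = l \<or> rank l < rank r)"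
  proof
    fix y assume "y \<in> E"
    then consider "y = u" | "y = v" | "y \<in> E0" by (auto simp: E_def)
    then show "\<exists>l r. connects y l r \<and> (y = l \<or> rank l < rank r)"
    proof cases
      case 1
      have "rank l < rank \<kappa>" using l(2) rank_\<kappa> by simp
      with 1 l(1) show ?thesis by blast
    next
      case 2
      have "rank \<kappa> < rank r" using r(2) rank_\<kappa> by simp
      with 2 r(1) show ?thesis by blast
    next
      case 3
      then show ?thesis using conn by blast
    qed
  qed
  from bchoice[OF conn'] obtain lf where
    "\<forall>y\<in>E. \<exists>r. connects y (lf y) r \<and> (y = lf y \<or> rank (lf y) < rank r)" by blast
  from bchoice[OF this] obtain rt where ends:
    "\<And>y. y \<in> E \<Longrightarrow> connects y (lf y) (rt y) \<and> (y = lf y \<or> rank (lf y) < rank (rt y))"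
    by blast
  have finE: "finite E" using E0(1) by (simp add: E_def)
  obtain L a where La: "0 < L" "0 \<le> a" "\<And>y. y \<in> E \<Longrightarrow> periodic L (lf y)" "\<And>y. y \<in> E \<Longrightarrow> periodic L (rt y)"
    "\<And>y j. y \<in> E \<Longrightarrow> j < -a \<Longrightarrow> y j = lf y j" "\<And>y j. y \<in> E \<Longrightarrow> a \<le> j \<Longrightarrow> y j = rt y j"
    using graded_constants[OF finE, of lf rt] ends by blast
  interpret graded_family E lf rt rank L a
    by unfold_locales (use La rank ends in blast)+
  have uE: "u \<in> E" and vE: "v \<in> E" by (simp_all add: E_def)
  have ends_u: "lf u = l" "rt u = \<kappa>"
    using connects_unique[OF _ l(1)] ends[OF uE] by blast+
  have ends_v: "lf v = \<kappa>" "rt v = r"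
    using connects_unique[OF _ r(1)] ends[OF vE] by blast+
  let ?Y = "factor_closure E"
  have E: "E \<subseteq> points" "\<forall>w\<in>language (Suc N) X. \<exists>y\<in>E. \<exists>i. factor y i (Suc N) = w"
    using E0(2,3) u(1) v(1) by (auto simp: E_def)
  have sY: "subshift ?Y" and langY: "language (Suc N) ?Y = language (Suc N) X"
    using factor_closure_subshift_points[OF sX E] by blast+
  have rank1: "\<And>t. rank t = 1 \<longleftrightarrow> t \<in> orbit \<kappa>" using rank(3) by blast
  have "one_middle_cycle (rauzy_graph ?Y (Suc (nat (6 * a + 4 * L))))"
    by (rule one_middle_cycle_if_graded[OF _ language_factor_closure uE ends_u(2) _ vE ends_v(1) _ rank1])
      (use ends_u ends_v l(2) r(2) in simp_all)
  then have OMC: "?Y \<in> OMC"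
    unfolding OMC_def using sY by (metis (mono_tags, lifting) Suc_le_mono le0 One_nat_def mem_Collect_eq)
  have "connects \<kappa> \<kappa> \<kappa>"
    unfolding connects_def left_tail_def right_tail_def using per_\<kappa> by simp
  then have ne: "u \<noteq> \<kappa>" "v \<noteq> \<kappa>"
    using connects_unique[OF _ l(1)] connects_unique[OF _ r(1)] l(2) r(2) rank_\<kappa> by auto
  have tails_\<kappa>: "right_tail u \<kappa>" "left_tail v \<kappa>"
    using l(1) r(1) by (simp_all add: connects_def)
  have \<kappa>Y: "\<kappa> \<in> ?Y"
    using factor_right_tail[OF tails_\<kappa>(1)] per_\<kappa> uE unfolding factor_closure_def by blast
  have uvY: "u \<in> ?Y" "v \<in> ?Y"
    using uE vE subset_factor_closure by blast+
  have "sft.middle M (language (Suc M) ?Y) \<kappa>" for M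
  proof -
    interpret Y: sft M "language (Suc M) ?Y" by (rule sft_language[OF sY])
    have "y \<in> Y.points" if "y \<in> ?Y" for y
      using that by (auto simp: Y.points_def intro: factor_in_language)
    then show ?thesis
      unfolding Y.middle_def using \<kappa>Y uvY ne tails_\<kappa> per_\<kappa> by blast
  qed
  then have "?Y \<in> non_isolated_subshifts"
    by (rule not_isolated_if_middle[OF sY \<kappa>Y])
  with OMC langY that show ?thesis by blast
qed

lemma openin_OMC: "openin subshift_space.mtopology OMC"
  unfolding openin_subshifts_iff
proof (intro conjI ballI)
  show "OMC \<subseteq> Collect subshift" by (auto simp: OMC_def)
  fix X assume "X \<in> OMC"
  then obtain n where n: "1 \<le> n" "one_middle_cycle (rauzy_graph X n)"
    by (auto simp: OMC_def)
  have "Y \<in> OMC" if Y: "subshift Y" "language n Y = language n X" for Y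
  proof -
    have "rauzy_graph Y n = rauzy_graph X n"
      using Y(2) language_eq_if_le[OF Y(2), of "n - 1"] by (simp add: rauzy_graph_def)
    then show ?thesis using n Y(1) by (auto simp: OMC_def)
  qed
  then show "\<exists>n. \<forall>Y. subshift Y \<longrightarrow> language n Y = language n X \<longrightarrow> Y \<in> OMC" by blast
qed

text \<open>Having OMC at level \<open>n\<close> depends only on the words of length \<open>n\<close>, so the OMC subshifts form an open set,
and the dense \<open>G\<^sub>\<delta>\<close> set can be taken to be all of them.\<close>

theorem corollary4p10:
  shows "residual_in (subtopology subshift_space.mtopology non_isolated_subshifts)
           (OMC \<inter> non_isolated_subshifts)"
proof -
  let ?T = "subtopology subshift_space.mtopology non_isolated_subshifts"
  have sub: "non_isolated_subshifts \<subseteq> Collect subshift"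
    by (auto simp: non_isolated_subshifts_def)
  have "openin ?T (OMC \<inter> non_isolated_subshifts)"
    using openin_OMC by (rule openin_subtopology_Int)
  then have "gdelta_in ?T (OMC \<inter> non_isolated_subshifts)"
    by (rule open_imp_gdelta_in)
  moreover have "?T closure_of (OMC \<inter> non_isolated_subshifts) = topspace ?T"
  proof (rule dense_intersects_open[THEN iffD2], intro allI impI)
    fix U assume U: "openin ?T U \<and> U \<noteq> {}"
    then obtain X V where V: "openin subshift_space.mtopology V" "U = V \<inter> non_isolated_subshifts" "X \<in> U"
      by (auto simp: openin_subtopology)
    then obtain n where n: "\<And>Y. subshift Y \<Longrightarrow> language n Y = language n X \<Longrightarrow> Y \<in> V"
      unfolding openin_subshifts_iff by blast
    obtain Y where Y: "Y \<in> OMC" "Y \<in> non_isolated_subshifts" "language (Suc n) Y = language (Suc n) X"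
      using OMC_near_non_isolated[of X n] V by blast
    then have "Y \<in> V"
      using n language_eq_if_le[OF Y(3), of n] sub by auto
    with Y V(2) show "(OMC \<inter> non_isolated_subshifts) \<inter> U \<noteq> {}" by blast
  qed
  ultimately show ?thesis
    unfolding residual_in_def by blast
qed

end
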